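(* Let $(T(t))_{t\ge0}$ be a $C_0$-semigroup of contractions on a complex Hilbert space $X$, with generator $A$, and let $U$ be another complex Hilbert space. Let $B\in\mathcal{B}(U,X)$ and let $(T_B(t))_{t\ge0}$ be the $C_0$-semigroup of contractions on $X$ generated by the operator $A_B=A-BB^*$ with domain $D(A_B)=D(A)$. Suppose there exist constants $K,\tau>0$ and $\beta\in(0,1]$ such that $$\|(I-A)^{-\beta}x\|^2\le K\int_0^\tau\|B^*T(t)x\|^2\,\mathrm{d} t,\qquad x\in X.$$ Then $\|T_B(t)x\|=o(t^{-1/(2\beta)})$ as $t\to\infty$ for all $x\in D(A_B)$.
   Context: $\mathcal{B}(U,X)$ is the space of bounded linear operators from $U$ to $X$. $(I-A)^{-\beta}$ is the usual fractional power, given by $(I-A)^{-\beta}=\frac{1}{\Gamma(\beta)}\int_0^\infty t^{\beta-1}e^{-t}T(t)\,\mathrm{d}t$ (strong integral). *)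

theory Defs
  imports "HOL-Analysis.Analysis" "HOL-Library.Landau_Symbols"
begin

text \<open>
  Complex Hilbert spaces, on top of the real normed structure of the library. The inner product
  is linear in its first argument; its definiteness is part of \<open>norm_eq_cinner\<close>.
\<close>

class complex_inner = real_normed_vector +
  fixes scaleC :: "complex \<Rightarrow> 'a \<Rightarrow> 'a"  (infixr \<open>*\<^sub>C\<close> 75)
    and cinner :: "'a \<Rightarrow> 'a \<Rightarrow> complex"
  assumes scaleC_add_right: "c *\<^sub>C (x + y) = c *\<^sub>C x + c *\<^sub>C y"
    and scaleC_add_left: "(c + d) *\<^sub>C x = c *\<^sub>C x + d *\<^sub>C x"
    and scaleC_scaleC: "c *\<^sub>C d *\<^sub>C x = (c * d) *\<^sub>C x"
    and scaleC_of_real: "complex_of_real r *\<^sub>C x = r *\<^sub>R x"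
    and cinner_commute: "cinner x y = cnj (cinner y x)"
    and cinner_add_left: "cinner (x + y) z = cinner x z + cinner y z"
    and cinner_scaleC_left: "cinner (c *\<^sub>C x) y = c * cinner x y"
    and norm_eq_cinner: "cinner x x = complex_of_real ((norm x)\<^sup>2)"

class complex_hilbert = complex_inner + banach

instantiation complex :: complex_hilbert
begin

definition scaleC_complex :: "complex \<Rightarrow> complex \<Rightarrow> complex"
  where "scaleC_complex c x = c * x"

definition cinner_complex :: "complex \<Rightarrow> complex \<Rightarrow> complex"
  where "cinner_complex x y = x * cnj y"

instance
proof
  fix c d x y z :: complex and r :: real
  show "c *\<^sub>C (x + y) = c *\<^sub>C x + c *\<^sub>C y"
    and "(c + d) *\<^sub>C x = c *\<^sub>C x + d *\<^sub>C x"
    and "c *\<^sub>C d *\<^sub>C x = (c * d) *\<^sub>C x"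
    by (simp_all add: scaleC_complex_def distrib_left distrib_right mult.assoc)
  show "complex_of_real r *\<^sub>C x = r *\<^sub>R x"
    by (simp only: scaleC_complex_def scaleR_conv_of_real)
  show "cinner x y = cnj (cinner y x)"
    by (simp add: cinner_complex_def mult.commute)
  show "cinner (x + y) z = cinner x z + cinner y z"
    by (simp add: cinner_complex_def distrib_right)
  show "cinner (c *\<^sub>C x) y = c * cinner x y"
    by (simp add: cinner_complex_def scaleC_complex_def mult.assoc)
  show "cinner x x = complex_of_real ((norm x)\<^sup>2)"
    by (simp only: cinner_complex_def complex_norm_square)
qed

end

definition bounded_clinear :: "('a::complex_inner \<Rightarrow> 'b::complex_inner) \<Rightarrow> bool"
  where "bounded_clinear f \<longleftrightarrow> bounded_linear f \<and> (\<forall>c x. f (c *\<^sub>C x) = c *\<^sub>C f x)"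

text \<open>The adjoint of a bounded operator between Hilbert spaces; it exists and is unique there.\<close>

definition cadjoint :: "('a::complex_inner \<Rightarrow> 'b::complex_inner) \<Rightarrow> 'b \<Rightarrow> 'a"
  where "cadjoint f = (SOME g. \<forall>x y. cinner (f x) y = cinner x (g y))"

text \<open>Semigroups are functions on all of \<open>real\<close>, but only their values at \<open>t \<ge> 0\<close> matter.\<close>

definition C0_semigroup :: "(real \<Rightarrow> 'a::complex_inner \<Rightarrow> 'a) \<Rightarrow> bool"
  where "C0_semigroup T \<longleftrightarrow>
    (\<forall>t\<ge>0. bounded_clinear (T t)) \<and>
    (\<forall>x. T 0 x = x) \<and>
    (\<forall>s\<ge>0. \<forall>t\<ge>0. \<forall>x. T (s + t) x = T s (T t x)) \<and>
    (\<forall>x. ((\<lambda>t. T t x) \<longlongrightarrow> x) (at_right 0))"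

definition contraction_C0_semigroup :: "(real \<Rightarrow> 'a::complex_inner \<Rightarrow> 'a) \<Rightarrow> bool"
  where "contraction_C0_semigroup T \<longleftrightarrow>
    C0_semigroup T \<and> (\<forall>t\<ge>0. \<forall>x. norm (T t x) \<le> norm x)"

text \<open>
  An unbounded operator is given by its domain \<open>D\<close> and a function \<open>A\<close>, of which only the
  values on \<open>D\<close> matter.
\<close>

definition is_generator ::
    "(real \<Rightarrow> 'a::complex_inner \<Rightarrow> 'a) \<Rightarrow> 'a set \<Rightarrow> ('a \<Rightarrow> 'a) \<Rightarrow> bool"
  where "is_generator T D A \<longleftrightarrow>
    D = {x. \<exists>y. ((\<lambda>t. (1 / t) *\<^sub>R (T t x - x)) \<longlongrightarrow> y) (at_right 0)} \<and>
    (\<forall>x\<in>D. ((\<lambda>t. (1 / t) *\<^sub>R (T t x - x)) \<longlongrightarrow> A x) (at_right 0))"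

text \<open>
  The fractional power \<open>(I - A)\<close> to the \<open>-\<beta>\<close>, for \<open>A\<close> the generator of the contraction
  semigroup \<open>T\<close>. The integral is the vector-valued Henstock--Kurzweil integral, since the
  Bochner integral of the library requires a separable space; for the present integrand,
  continuous on \<open>t > 0\<close> and dominated in norm by an integrable function, it exists and is
  the usual strong integral.
\<close>

definition resolvent_power ::
    "(real \<Rightarrow> 'a::complex_hilbert \<Rightarrow> 'a) \<Rightarrow> real \<Rightarrow> 'a \<Rightarrow> 'a"
  where "resolvent_power T \<beta> x =
    (1 / Gamma \<beta>) *\<^sub>R integral {0..} (\<lambda>t. (t powr (\<beta> - 1) * exp (- t)) *\<^sub>R T t x)"

end

theory Submission imports Defs begin

text \<open>
  For \<open>x \<in> D\<close> the energy \<open>\<parallel>T\<^sub>B t x\<parallel>\<^sup>2\<close> decreases at least at the rate \<open>2 \<parallel>B\<^sup>* T\<^sub>B t x\<parallel>\<^sup>2\<close>, and on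
  \<open>[0, \<tau>]\<close> an energy estimate for \<open>T t x - T\<^sub>B t x\<close> lets one replace \<open>T\<^sub>B\<close> by \<open>T\<close> in the
  dissipation integral. The observability assumption then bounds the energy loss over a time
  \<open>\<tau>\<close> from below by a multiple of \<open>\<parallel>(I - A)\<^bsup>-\<beta>\<^esup> x\<parallel>\<^sup>2\<close>, hence, by the moment inequality
  \<open>\<parallel>x\<parallel>\<^bsup>1+\<beta>\<^esup> \<le> C \<parallel>(I - A)\<^bsup>-\<beta>\<^esup> x\<parallel> \<parallel>(I - A) x\<parallel>\<^bsup>\<beta>\<^esup>\<close>, by a multiple of the power \<open>1 + \<beta>\<close> of the
  energy itself. So the energies at the times \<open>n \<tau>\<close> satisfy
  \<open>c a\<^sub>n\<^bsup>1+\<beta>\<^esup> \<le> a\<^sub>n - a\<^sub>n\<^sub>+\<^sub>1\<close>, whence \<open>a\<^sub>n = O(n\<^bsup>-1/\<beta>\<^esup>)\<close>, with a constant that is uniform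
  on bounded sets for the graph norm. As the graph norm of \<open>T\<^sub>B t x\<close> tends to \<open>0\<close>, this improves
  to little-o.
\<close>

subsection \<open>The real inner product and adjoints\<close>

text \<open>The underlying real inner product: it induces the same norm and is real bilinear, so the
  real calculus of bounded bilinear maps applies. Energy estimates, Riesz representation and moment
  inequality are all stated with it.\<close>

definition rinner :: "'a::complex_inner \<Rightarrow> 'a \<Rightarrow> real"
  where "rinner x y = Re (cinner x y)"

lemma rinner_commute: "rinner x y = rinner y x"
  unfolding rinner_def by (subst cinner_commute) simp

lemma rinner_add_left: "rinner (x + y) z = rinner x z + rinner y z"
  by (simp add: rinner_def cinner_add_left)

lemma rinner_scaleR_left: "rinner (r *\<^sub>R x) y = r * rinner x y"
  unfolding rinner_def by (subst scaleC_of_real [symmetric]) (simp add: cinner_scaleC_left)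

lemma rinner_add_right: "rinner z (x + y) = rinner z x + rinner z y"
  by (metis rinner_add_left rinner_commute)

lemma rinner_scaleR_right: "rinner y (r *\<^sub>R x) = r * rinner y x"
  by (metis rinner_scaleR_left rinner_commute)

lemma rinner_self: "rinner x x = (norm x)\<^sup>2"
  by (simp add: rinner_def norm_eq_cinner)

lemma rinner_minus_left: "rinner (- x) y = - rinner x y"
  using rinner_scaleR_left [of "-1" x y] by simp

lemma rinner_minus_right: "rinner y (- x) = - rinner y x"
  using rinner_scaleR_right [of y "-1" x] by simp

lemma rinner_diff_left: "rinner (x - y) z = rinner x z - rinner y z"
  using rinner_add_left [of x "- y" z] by (simp add: rinner_minus_left)

lemma rinner_diff_right: "rinner z (x - y) = rinner z x - rinner z y"
  using rinner_add_right [of z x "- y"] by (simp add: rinner_minus_right)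

lemma rinner_zero_left [simp]: "rinner 0 y = 0"
  using rinner_scaleR_left [of 0 y y] by simp

lemma rinner_zero_right [simp]: "rinner y 0 = 0"
  by (metis rinner_commute rinner_zero_left)

lemma norm_add_power2: "(norm (x + y))\<^sup>2 = (norm x)\<^sup>2 + 2 * rinner x y + (norm y)\<^sup>2"
  for x y :: "'a::complex_inner"
  by (simp add: rinner_self [symmetric] rinner_add_left rinner_add_right rinner_commute [of y x])

lemma norm_diff_power2: "(norm (x - y))\<^sup>2 = (norm x)\<^sup>2 - 2 * rinner x y + (norm y)\<^sup>2"
  for x y :: "'a::complex_inner"
  by (simp add: rinner_self [symmetric] rinner_diff_left rinner_diff_right rinner_commute [of y x])

text \<open>Cauchy-Schwarz, by expanding the nonnegative square of
  \<open>norm y *\<^sub>R x - norm x *\<^sub>R y\<close>.\<close>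

lemma rinner_le_norm: "rinner x y \<le> norm x * norm y"
proof (cases "norm x = 0 \<or> norm y = 0")
  case True
  then show ?thesis by auto
next
  case False
  have "0 \<le> (norm (norm y *\<^sub>R x - norm x *\<^sub>R y))\<^sup>2" by simp
  also have "\<dots> = 2 * (norm x * norm y) * (norm x * norm y - rinner x y)"
    by (simp only: norm_diff_power2 rinner_scaleR_left rinner_scaleR_right norm_scaleR)
       (simp add: power2_eq_square algebra_simps)
  finally have "0 \<le> 2 * (norm x * norm y) * (norm x * norm y - rinner x y)" .
  moreover have "0 < 2 * (norm x * norm y)" using False by simp
  ultimately have "0 \<le> norm x * norm y - rinner x y" by (metis mult_pos_neg not_less)
  then show ?thesis by simp
qed

lemma abs_rinner_le_norm: "\<bar>rinner x y\<bar> \<le> norm x * norm y"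
  using rinner_le_norm [of x y] rinner_le_norm [of "- x" y] by (simp add: rinner_minus_left abs_le_iff)

lemma bounded_bilinear_rinner: "bounded_bilinear rinner"
proof
  show "\<exists>K. \<forall>a b. norm (rinner a b) \<le> norm a * norm b * K"
    by (rule exI [of _ 1]) (simp add: abs_rinner_le_norm)
qed (auto simp: rinner_add_left rinner_add_right rinner_scaleR_left rinner_scaleR_right)

lemmas bounded_linear_rinner_left = bounded_bilinear.bounded_linear_left [OF bounded_bilinear_rinner]

section \<open>Riesz representation and existence of adjoints\<close>

lemma rinner_ext:
  assumes "\<And>x. rinner x y = rinner x z"
  shows "y = z"
proof -
  have "rinner (y - z) (y - z) = 0"
    by (simp add: rinner_diff_right assms)
  then show ?thesis by (simp add: rinner_self)
qed

text \<open>Multiplying by \<open>\<i>\<close> turns the imaginary part of the inner product into a real part.\<close>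

lemma cinner_eqI:
  assumes "\<And>x. rinner (f x) y = rinner x z" and "\<And>c x. f (c *\<^sub>C x) = c *\<^sub>C f x"
  shows "cinner (f x) y = cinner x z"
proof (rule complex_eqI)
  show "Re (cinner (f x) y) = Re (cinner x z)"
    using assms(1) [of x] by (simp add: rinner_def)
  show "Im (cinner (f x) y) = Im (cinner x z)"
    using assms(1) [of "\<i> *\<^sub>C x"] by (simp add: rinner_def assms(2) cinner_scaleC_left)
qed

text \<open>The representing vector is the minimiser of the quadratic functional \<open>J\<close>.
  It exists because minimising sequences are Cauchy, and the vanishing first variation of
  \<open>J\<close> at it is the representation.\<close>

lemma riesz_representation:
  fixes \<phi> :: "'a::complex_hilbert \<Rightarrow> real"
  assumes "bounded_linear \<phi>"
  obtains z where "\<And>x. \<phi> x = rinner x z"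
proof -
  interpret \<phi>: bounded_linear \<phi> by fact
  define J where "J x = (norm x)\<^sup>2 - 2 * \<phi> x" for x
  obtain M where M: "\<And>x. norm (\<phi> x) \<le> norm x * M" using \<phi>.bounded by blast
  have below: "- M\<^sup>2 \<le> J x" for x
  proof -
    have "\<phi> x \<le> norm x * M" using M [of x] by simp
    moreover have "0 \<le> (norm x - M)\<^sup>2" by simp
    ultimately show ?thesis
      unfolding J_def by (simp add: power2_eq_square algebra_simps)
  qed
  have bdd: "bdd_below (range J)" by (rule bdd_belowI2 [OF below])
  define m where "m = Inf (range J)"
  have m_le: "m \<le> J x" for x unfolding m_def by (rule cInf_lower) (auto intro: bdd)
  have "\<exists>x. J x < m + e" if "e > 0" for e
    using cInf_lessD [of "range J" "m + e"] that by (auto simp: m_def)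
  then have "\<exists>x. J x < m + inverse (real (Suc n))" for n by simp
  then obtain x where x: "\<And>n. J (x n) < m + inverse (real (Suc n))"
    by metis
  \<comment> \<open>Parallelogram identity: \<open>J\<close> is at least \<open>m\<close> at the
    midpoint of \<open>a\<close> and \<open>b\<close>, so two near-minimisers must be close to each
    other.\<close>
  have gap: "(norm (a - b))\<^sup>2 \<le> 2 * (J a - m) + 2 * (J b - m)" for a b
  proof -
    have "4 * J ((1/2) *\<^sub>R (a + b)) = (norm (a + b))\<^sup>2 - 4 * \<phi> (a + b)"
      by (simp add: J_def \<phi>.scaleR power_divide)
    then have "(norm (a - b))\<^sup>2 = 2 * J a + 2 * J b - 4 * J ((1/2) *\<^sub>R (a + b))"
      by (simp add: norm_diff_power2 norm_add_power2 J_def \<phi>.add)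
    with m_le [of "(1/2) *\<^sub>R (a + b)"] show ?thesis by simp
  qed
  have "Cauchy x"
  proof (rule metric_CauchyI)
    fix e :: real assume "e > 0"
    then obtain N where N: "inverse (real (Suc N)) < e\<^sup>2 / 4"
      using reals_Archimedean [of "e\<^sup>2 / 4"] by auto
    have le: "J (x n) - m < e\<^sup>2 / 4" if "n \<ge> N" for n
    proof -
      have "inverse (real (Suc n)) \<le> inverse (real (Suc N))" using that by (simp add: le_imp_inverse_le)
      then show ?thesis using x [of n] N by linarith
    qed
    have "dist (x p) (x q) < e" if "p \<ge> N" "q \<ge> N" for p q
    proof -
      have "(norm (x p - x q))\<^sup>2 < e\<^sup>2" using gap [of "x p" "x q"] le [OF that(1)] le [OF that(2)] by simp
      then show ?thesis using \<open>e > 0\<close> by (simp add: dist_norm power2_less_imp_less)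
    qed
    then show "\<exists>M. \<forall>m\<ge>M. \<forall>n\<ge>M. dist (x m) (x n) < e" by blast
  qed
  then obtain z where z: "x \<longlonglongrightarrow> z" using convergent_eq_Cauchy by (auto simp: convergent_def)
  have "(\<lambda>n. J (x n)) \<longlonglongrightarrow> J z"
    unfolding J_def by (intro tendsto_intros z \<phi>.tendsto)
  moreover have "(\<lambda>n. m + inverse (real (Suc n))) \<longlonglongrightarrow> m + 0"
    by (intro tendsto_intros LIMSEQ_inverse_real_of_nat)
  ultimately have "J z \<le> m + 0"
    by (rule LIMSEQ_le) (intro exI allI impI less_imp_le x)
  then have min: "J z \<le> J y" for y using m_le [of y] by simp
  have "\<phi> y = rinner y z" for y
  proof (rule ccontr)
    assume ne: "\<phi> y \<noteq> rinner y z"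
    define d where "d = \<phi> y - rinner y z"
    \<comment> \<open>Moving from \<open>z\<close> by \<open>s *\<^sub>R y\<close> changes
      \<open>J\<close> by \<open>s\<^sup>2 * (norm y)\<^sup>2 - 2 * s * d\<close>. The optimal step
      is \<open>d\<close> over the squared norm of \<open>y\<close>; adding 1 to the denominator
      covers \<open>y = 0\<close> and still makes the change negative.\<close>
    define s where "s = d / ((norm y)\<^sup>2 + 1)"
    have pos: "(norm y)\<^sup>2 + 1 > 0" by (simp add: add_nonneg_pos)
    have "J (z + s *\<^sub>R y) = J z - 2 * s * d + s\<^sup>2 * (norm y)\<^sup>2"
      by (simp add: J_def norm_add_power2 \<phi>.add \<phi>.scaleR rinner_scaleR_right d_def
          rinner_commute [of z y] power_mult_distrib algebra_simps)
    with min have "2 * s * d \<le> s\<^sup>2 * (norm y)\<^sup>2" by (metis diff_add_cancel diff_ge_0_iff_ge add_diff_eq add_le_cancel_left diff_le_eq le_diff_eq)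
    also have "\<dots> \<le> s\<^sup>2 * ((norm y)\<^sup>2 + 1)" by (intro mult_left_mono) auto
    also have "\<dots> = s * d" using pos by (simp add: s_def power2_eq_square)
    finally have "s * d \<le> 0" by (simp add: mult.commute)
    moreover have "s * d > 0"
      using ne pos by (simp add: s_def d_def power2_eq_square [symmetric] zero_less_divide_iff)
    ultimately show False by simp
  qed
  then show ?thesis by (rule that)
qed

text \<open>Justifies the choice in the definition: Riesz gives a vector for each \<open>y\<close>
  that matches the real parts, and complex linearity of \<open>B\<close> upgrades this to the
  complex inner product.\<close>

lemma cadjoint:
  fixes B :: "'u::complex_hilbert \<Rightarrow> 'x::complex_hilbert"
  assumes "bounded_clinear B"
  shows "cinner (B x) y = cinner x (cadjoint B y)"
proof -
  have B: "bounded_linear B" "\<And>c x. B (c *\<^sub>C x) = c *\<^sub>C B x"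
    using assms by (auto simp: bounded_clinear_def)
  have "\<exists>z. \<forall>x. rinner (B x) y = rinner x z" for y
    using riesz_representation [OF bounded_linear_compose [OF bounded_linear_rinner_left B(1), of y]] by metis
  then obtain g where "\<And>x y. rinner (B x) y = rinner x (g y)" by metis
  then have "\<exists>g. \<forall>x y. cinner (B x) y = cinner x (g y)"
    using cinner_eqI [of B] B(2) by metis
  then have "\<forall>x y. cinner (B x) y = cinner x (cadjoint B y)"
    unfolding cadjoint_def by (rule someI_ex)
  then show ?thesis by blast
qed

lemma rinner_cadjoint:
  fixes B :: "'u::complex_hilbert \<Rightarrow> 'x::complex_hilbert"
  assumes "bounded_clinear B"
  shows "rinner (B x) y = rinner x (cadjoint B y)"
  by (simp add: rinner_def cadjoint [OF assms])

text \<open>Linearity follows from uniqueness of representing vectors; the norm bound comes from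
  testing the adjoint relation with \<open>cadjoint B y\<close> itself, so the bound for
  \<open>B\<close> is inherited.\<close>

lemma bounded_linear_cadjoint:
  fixes B :: "'u::complex_hilbert \<Rightarrow> 'x::complex_hilbert"
  assumes "bounded_clinear B"
  shows "bounded_linear (cadjoint B)"
proof -
  note adj = rinner_cadjoint [OF assms, symmetric]
  have "bounded_linear B" using assms by (simp add: bounded_clinear_def)
  then obtain M where M: "M \<ge> 0" "\<And>x. norm (B x) \<le> norm x * M"
    using bounded_linear.nonneg_bounded by blast
  show ?thesis
  proof (rule bounded_linear_intro [where K = M])
    show "cadjoint B (x + y) = cadjoint B x + cadjoint B y" for x y
      by (rule rinner_ext) (simp add: adj rinner_add_right)
    show "cadjoint B (r *\<^sub>R x) = r *\<^sub>R cadjoint B x" for r x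
      by (rule rinner_ext) (simp add: adj rinner_scaleR_right)
    show "norm (cadjoint B y) \<le> norm y * M" for y
    proof (cases "cadjoint B y = 0")
      case True
      then show ?thesis using M by simp
    next
      case False
      have "norm (cadjoint B y) * norm (cadjoint B y) = rinner (B (cadjoint B y)) y"
        by (simp add: adj [symmetric] rinner_self power2_eq_square)
      also have "\<dots> \<le> norm (B (cadjoint B y)) * norm y" by (rule rinner_le_norm)
      also have "\<dots> \<le> (norm (cadjoint B y) * M) * norm y" by (intro mult_right_mono M) auto
      also have "\<dots> = norm (cadjoint B y) * (norm y * M)" by simp
      finally show ?thesis using False by simp
    qed
  qed
qed

subsection \<open>Contraction semigroups\<close>

locale contraction_semigroup =
  fixes T :: "real \<Rightarrow> 'x::complex_hilbert \<Rightarrow> 'x" and D :: "'x set" and A :: "'x \<Rightarrow> 'x"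
  assumes contraction_C0: "contraction_C0_semigroup T"
    and generator: "is_generator T D A"
begin

lemma bounded_linear: "t \<ge> 0 \<Longrightarrow> bounded_linear (T t)"
  using contraction_C0 by (auto simp: contraction_C0_semigroup_def C0_semigroup_def bounded_clinear_def)

lemmas diff = linear_diff [OF bounded_linear.linear [OF bounded_linear]]
  and scaleR = linear_scale [OF bounded_linear.linear [OF bounded_linear]]

lemma at_zero [simp]: "T 0 x = x"
  using contraction_C0 by (auto simp: contraction_C0_semigroup_def C0_semigroup_def)

lemma semigroup: "s \<ge> 0 \<Longrightarrow> t \<ge> 0 \<Longrightarrow> T (s + t) x = T s (T t x)"
  using contraction_C0 by (auto simp: contraction_C0_semigroup_def C0_semigroup_def)

lemma tendsto_at_zero: "((\<lambda>t. T t x) \<longlongrightarrow> x) (at_right 0)"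
  using contraction_C0 by (auto simp: contraction_C0_semigroup_def C0_semigroup_def)

lemma contraction: "t \<ge> 0 \<Longrightarrow> norm (T t x) \<le> norm x"
  using contraction_C0 by (auto simp: contraction_C0_semigroup_def)

lemma in_domainI: "((\<lambda>t. (1 / t) *\<^sub>R (T t x - x)) \<longlongrightarrow> y) (at_right 0) \<Longrightarrow> x \<in> D"
  using generator by (auto simp: is_generator_def)

lemma generator_tendsto:
  "x \<in> D \<Longrightarrow> ((\<lambda>t. (1 / t) *\<^sub>R (T t x - x)) \<longlongrightarrow> A x) (at_right 0)"
  using generator by (auto simp: is_generator_def)

lemma generator_eqI:
  assumes "((\<lambda>t. (1 / t) *\<^sub>R (T t x - x)) \<longlongrightarrow> y) (at_right 0)"
  shows "A x = y"
  by (rule tendsto_unique [OF _ generator_tendsto [OF in_domainI [OF assms]] assms]) simp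

lemma norm_antimono: "0 \<le> s \<Longrightarrow> s \<le> t \<Longrightarrow> norm (T t x) \<le> norm (T s x)"
  using semigroup [of "t - s" s x] contraction [of "t - s" "T s x"] by simp

lemma domain_diff:
  assumes "x \<in> D" and "y \<in> D"
  shows "x - y \<in> D" and "A (x - y) = A x - A y"
proof -
  have "((\<lambda>t. (1 / t) *\<^sub>R (T t x - x) - (1 / t) *\<^sub>R (T t y - y)) \<longlongrightarrow> A x - A y) (at_right 0)"
    by (intro tendsto_intros generator_tendsto assms)
  moreover have "eventually (\<lambda>t. (1 / t) *\<^sub>R (T t x - x) - (1 / t) *\<^sub>R (T t y - y)
      = (1 / t) *\<^sub>R (T t (x - y) - (x - y))) (at_right 0)"
    by (intro eventually_at_rightI [of 0 1]) (auto simp: diff algebra_simps scaleR_diff_right)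
  ultimately have "((\<lambda>t. (1 / t) *\<^sub>R (T t (x - y) - (x - y))) \<longlongrightarrow> A x - A y) (at_right 0)"
    by (rule Lim_transform_eventually)
  then show "x - y \<in> D" and "A (x - y) = A x - A y"
    by (auto intro: in_domainI generator_eqI)
qed

lemma domain_scaleR:
  assumes "x \<in> D"
  shows "c *\<^sub>R x \<in> D" 
proof -
  have "((\<lambda>t. c *\<^sub>R ((1 / t) *\<^sub>R (T t x - x))) \<longlongrightarrow> c *\<^sub>R A x) (at_right 0)"
    by (intro tendsto_intros generator_tendsto assms)
  moreover have "eventually (\<lambda>t. c *\<^sub>R ((1 / t) *\<^sub>R (T t x - x))
      = (1 / t) *\<^sub>R (T t (c *\<^sub>R x) - c *\<^sub>R x)) (at_right 0)"
    by (intro eventually_at_rightI [of 0 1]) (auto simp: scaleR algebra_simps scaleR_diff_right)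
  ultimately have "((\<lambda>t. (1 / t) *\<^sub>R (T t (c *\<^sub>R x) - c *\<^sub>R x)) \<longlongrightarrow> c *\<^sub>R A x) (at_right 0)"
    by (rule Lim_transform_eventually)
  then show ?thesis by (rule in_domainI)
qed

text \<open>The operator \<open>T t\<close> is continuous and commutes with the difference quotients
  at 0.\<close>

lemma orbit_in_domain:
  assumes "x \<in> D" and "t \<ge> 0"
  shows "T t x \<in> D" and "A (T t x) = T t (A x)"
proof -
  have "((\<lambda>s. T t ((1 / s) *\<^sub>R (T s x - x))) \<longlongrightarrow> T t (A x)) (at_right 0)"
    by (intro bounded_linear.tendsto [OF bounded_linear] generator_tendsto assms)
  moreover have "eventually (\<lambda>s. T t ((1 / s) *\<^sub>R (T s x - x))
      = (1 / s) *\<^sub>R (T s (T t x) - T t x)) (at_right 0)"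
    using assms(2)
    by (intro eventually_at_rightI [of 0 1])
       (auto simp: diff scaleR semigroup [symmetric] add.commute)
  ultimately have "((\<lambda>s. (1 / s) *\<^sub>R (T s (T t x) - T t x)) \<longlongrightarrow> T t (A x)) (at_right 0)"
    by (rule Lim_transform_eventually)
  then show "T t x \<in> D" and "A (T t x) = T t (A x)"
    by (auto intro: in_domainI generator_eqI)
qed

text \<open>Pair the difference quotient with \<open>x\<close>: by Cauchy-Schwarz and contractivity,
  \<open>rinner (T t x) x\<close> never exceeds the squared norm of \<open>x\<close>.\<close>

lemma dissipative:
  assumes "x \<in> D"
  shows "rinner (A x) x \<le> 0"
proof (rule tendsto_upperbound)
  show "((\<lambda>t. rinner ((1 / t) *\<^sub>R (T t x - x)) x) \<longlongrightarrow> rinner (A x) x) (at_right 0)"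
    by (intro bounded_linear.tendsto [OF bounded_linear_rinner_left] generator_tendsto assms)
  show "eventually (\<lambda>t. rinner ((1 / t) *\<^sub>R (T t x - x)) x \<le> 0) (at_right 0)"
  proof (rule eventually_at_rightI [of 0 1])
    fix t :: real assume "t \<in> {0<..<1}"
    then have "rinner (T t x) x \<le> norm x * norm x"
      using rinner_le_norm [of "T t x" x] mult_right_mono [OF contraction [of t x], of "norm x"] by simp
    then show "rinner ((1 / t) *\<^sub>R (T t x - x)) x \<le> 0"
      using \<open>t \<in> {0<..<1}\<close>
      by (simp add: rinner_scaleR_left rinner_diff_left rinner_self power2_eq_square divide_nonpos_pos)
  qed simp
qed simp

section \<open>Continuity and differentiability of orbits\<close>

lemma norm_orbit_diff_le:
  assumes "s \<ge> 0" and "t \<ge> 0"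
  shows "norm (T t x - T s x) \<le> norm (T \<bar>t - s\<bar> x - x)"
proof -
  \<comment> \<open>Factoring out the contraction \<open>T s\<close> moves the comparison to time 0,
    where strong continuity is assumed.\<close>
  have *: "norm (T t x - T s x) \<le> norm (T (t - s) x - x)" if "0 \<le> s" "s \<le> t" for s t
    using that semigroup [of s "t - s" x] contraction [of s "T (t - s) x - x"] by (simp add: diff)
  show ?thesis
    using * [of s t] * [of t s] assms by (cases "s \<le> t") (auto simp: norm_minus_commute)
qed

lemma continuous_on_orbit: "continuous_on {0..} (\<lambda>t. T t x)"
  unfolding continuous_on_iff
proof (intro ballI allI impI)
  fix s e :: real assume s: "s \<in> {0..}" and "e > 0"
  from tendstoD [OF tendsto_at_zero \<open>e > 0\<close>]
  obtain d where d: "d > 0" "\<And>t. 0 < t \<Longrightarrow> t < d \<Longrightarrow> norm (T t x - x) < e"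
    unfolding eventually_at_right_field by (auto simp: dist_norm)
  have "norm (T \<bar>t\<bar> x - x) < e" if "\<bar>t\<bar> < d" for t
    using d(2) [of "\<bar>t\<bar>"] that \<open>e > 0\<close> by (cases "t = 0") auto
  then have "dist (T t x) (T s x) < e" if "t \<in> {0..}" "dist t s < d" for t
    using norm_orbit_diff_le [of s t x] s that by (force simp: dist_norm)
  then show "\<exists>d>0. \<forall>t\<in>{0..}. dist t s < d \<longrightarrow> dist (T t x) (T s x) < e"
    using d(1) by blast
qed

text \<open>The generator only supplies a right derivative at 0. The two one-sided quotients at
  \<open>t\<close> are reduced to it separately and then glued into a two-sided derivative.\<close>

lemma orbit_has_vector_derivative:
  assumes x: "x \<in> D" and t: "t > 0"
  shows "((\<lambda>t. T t x) has_vector_derivative T t (A x)) (at t)"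
proof -
  have cont: "isCont (\<lambda>t. T t y) t" for y
    by (rule continuous_on_interior [OF continuous_on_orbit]) (use t in simp)
  have q0: "((\<lambda>h. norm ((1 / h) *\<^sub>R (T h x - x) - A x)) \<longlongrightarrow> 0) (at_right 0)"
    using tendsto_norm [OF LIM_zero [OF generator_tendsto [OF x]]] by simp
  have right: "((\<lambda>h. (1 / h) *\<^sub>R (T (t + h) x - T t x)) \<longlongrightarrow> T t (A x)) (at_right 0)"
  proof (rule Lim_transform_eventually)
    show "((\<lambda>h. T t ((1 / h) *\<^sub>R (T h x - x))) \<longlongrightarrow> T t (A x)) (at_right 0)"
      using t by (intro bounded_linear.tendsto [OF bounded_linear] generator_tendsto x) auto
    show "eventually (\<lambda>h. T t ((1 / h) *\<^sub>R (T h x - x)) = (1 / h) *\<^sub>R (T (t + h) x - T t x)) (at_right 0)"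
      using t by (intro eventually_at_rightI [of 0 1]) (auto simp: diff scaleR semigroup)
  qed
  \<comment> \<open>The left quotient is \<open>T (t - h)\<close> applied to the quotient at 0. As
    the operator moves with \<open>h\<close>, contractivity controls the error of the quotient, and
    continuity of the orbit of \<open>A x\<close> controls the rest.\<close>
  have left: "((\<lambda>h. (1 / h) *\<^sub>R (T t x - T (t - h) x)) \<longlongrightarrow> T t (A x)) (at_right 0)"
  proof -
    have "((\<lambda>h. T (t - h) (A x)) \<longlongrightarrow> T (t - 0) (A x)) (at_right 0)"
      by (rule isCont_tendsto_compose [where g = "\<lambda>t. T t (A x)"]) (simp add: cont, intro tendsto_intros)
    then have "((\<lambda>h. norm (T (t - h) (A x) - T t (A x))) \<longlongrightarrow> 0) (at_right 0)"
      using tendsto_norm [OF LIM_zero] by fastforce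
    from tendsto_add [OF q0 this]
    have lim: "((\<lambda>h. norm ((1 / h) *\<^sub>R (T h x - x) - A x) + norm (T (t - h) (A x) - T t (A x))) \<longlongrightarrow> 0) (at_right 0)"
      by simp
    have "((\<lambda>h. (1 / h) *\<^sub>R (T t x - T (t - h) x) - T t (A x)) \<longlongrightarrow> 0) (at_right 0)"
    proof (rule Lim_null_comparison [OF _ lim], rule eventually_at_rightI [of 0 t])
      fix h assume h: "h \<in> {0<..<t}"
      have "(1 / h) *\<^sub>R (T t x - T (t - h) x) - T t (A x)
          = T (t - h) ((1 / h) *\<^sub>R (T h x - x) - A x) + (T (t - h) (A x) - T t (A x))"
        using h semigroup [of "t - h" h x] by (simp add: diff scaleR)
      also have "norm \<dots> \<le> norm (T (t - h) ((1 / h) *\<^sub>R (T h x - x) - A x)) + norm (T (t - h) (A x) - T t (A x))"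
        by (rule norm_triangle_ineq)
      finally show "norm ((1 / h) *\<^sub>R (T t x - T (t - h) x) - T t (A x))
          \<le> norm ((1 / h) *\<^sub>R (T h x - x) - A x) + norm (T (t - h) (A x) - T t (A x))"
        using h contraction [of "t - h" "(1 / h) *\<^sub>R (T h x - x) - A x"] by simp
    qed (use t in simp)
    then show ?thesis by (rule LIM_zero_cancel)
  qed
  have "((\<lambda>h. (1 / h) *\<^sub>R (T (t + h) x - T t x)) \<longlongrightarrow> T t (A x)) (at 0)"
  proof (rule filterlim_split_at)
    show "((\<lambda>h. (1 / h) *\<^sub>R (T (t + h) x - T t x)) \<longlongrightarrow> T t (A x)) (at_left 0)"
    proof (subst filterlim_at_left_to_right)
      have eq: "(\<lambda>h. (1 / - h) *\<^sub>R (T (t + - h) x - T t x)) = (\<lambda>h. (1 / h) *\<^sub>R (T t x - T (t - h) x))"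
        by (rule ext) (simp add: scaleR_diff_right)
      show "((\<lambda>h. (1 / - h) *\<^sub>R (T (t + - h) x - T t x)) \<longlongrightarrow> T t (A x)) (at_right (- 0))"
        unfolding eq using left by simp
    qed
  qed (rule right)
  then have "((\<lambda>h. norm ((1 / h) *\<^sub>R (T (t + h) x - T t x) - T t (A x))) \<longlongrightarrow> 0) (at 0)"
    using tendsto_norm [OF LIM_zero] by fastforce
  moreover have "eventually (\<lambda>h. norm ((1 / h) *\<^sub>R (T (t + h) x - T t x) - T t (A x))
      = norm (T (t + h) x - T t x - h *\<^sub>R T t (A x)) / norm h) (at 0)"
  proof (rule eventually_mono [OF eventually_neq_at_within [of 0]])
    fix h :: real assume "h \<noteq> 0"
    then have "(1 / h) *\<^sub>R (T (t + h) x - T t x) - T t (A x)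
        = (1 / h) *\<^sub>R (T (t + h) x - T t x - h *\<^sub>R T t (A x))"
      by (simp add: scaleR_diff_right)
    then show "norm ((1 / h) *\<^sub>R (T (t + h) x - T t x) - T t (A x))
        = norm (T (t + h) x - T t x - h *\<^sub>R T t (A x)) / norm h"
      by simp
  qed
  ultimately have "((\<lambda>h. norm (T (t + h) x - T t x - h *\<^sub>R T t (A x)) / norm h) \<longlongrightarrow> 0) (at 0)"
    by (rule Lim_transform_eventually)
  then show ?thesis
    unfolding has_vector_derivative_def has_derivative_at by (simp add: bounded_linear_scaleR_left)
qed

end

subsection \<open>Fractional integrals\<close>

text \<open>At \<open>t = 0\<close> this vanishes even for \<open>a \<le> 0\<close>, since \<open>0 powr a = 0\<close>.\<close>

definition fpow :: "real \<Rightarrow> real \<Rightarrow> real"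
  where "fpow a t = indicator {0..} t * t powr a"

lemma fpow_simps: "t > 0 \<Longrightarrow> fpow a t = t powr a" "t \<le> 0 \<Longrightarrow> fpow a t = 0"
  by (auto simp: fpow_def indicator_def)

lemma fpow_nonneg: "fpow a t \<ge> 0"
  by (simp add: fpow_def)

lemma measurable_fpow [measurable]: "fpow a \<in> borel_measurable borel"
  unfolding fpow_def by measurable

lemma fpow_mult: "c > 0 \<Longrightarrow> fpow a (c * t) = c powr a * fpow a t"
  by (cases "t > 0") (auto simp: fpow_simps powr_mult mult_nonneg_nonpos)

text \<open>Passes from gauge integrals, in which the Gamma, Beta and power integrals are given, to
  Lebesgue integrals, on which Fubini and domination are used.\<close>

lemma has_bochner_integral_lborel_nonneg:
  fixes f :: "real \<Rightarrow> real"
  assumes "(f has_integral I) S" and "\<And>x. x \<in> S \<Longrightarrow> 0 \<le> f x"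
    and "(\<lambda>x. indicator S x * f x) \<in> borel_measurable borel"
  shows "has_bochner_integral lborel (\<lambda>x. indicator S x * f x) I"
proof (rule has_bochner_integral_nn_integral)
  show "0 \<le> I" using has_integral_nonneg [OF assms(1,2)] .
  show "(\<integral>\<^sup>+x. ennreal (indicator S x * f x) \<partial>lborel) = ennreal I"
    using nn_integral_has_integral_lebesgue [OF assms(2,1)] by simp
qed (use assms in \<open>auto simp: indicator_def\<close>)

text \<open>This is the Gamma integrand with parameter \<open>a + 1\<close>. It serves as the
  dominating function below; with \<open>a = 0\<close> it dominates every exponentially bounded
  function on the positive half-line.\<close>

lemma integrable_fpow_exp:
  assumes "a > -1"
  shows "integrable lborel (\<lambda>t. fpow a t * exp (- t))"
proof -
  have "((\<lambda>t. t powr (a + 1 - 1) / exp t) has_integral Gamma (a + 1)) {0..}"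
    by (rule Gamma_integral_real) (use assms in simp)
  from has_bochner_integral_lborel_nonneg [OF this]
  have "integrable lborel (\<lambda>t. indicator {0..} t * (t powr (a + 1 - 1) / exp t))"
    by (auto simp: has_bochner_integral_iff)
  then show ?thesis by (simp add: fpow_def exp_minus field_simps)
qed

lemma integrable_pair_mult:
  fixes p q :: "real \<Rightarrow> real"
  assumes "integrable lborel p" and "integrable lborel q"
  shows "integrable (lborel \<Otimes>\<^sub>M lborel) (\<lambda>(x, y). p x * q y)"
proof (rule lborel_pair.Fubini_integrable)
  have [measurable]: "p \<in> borel_measurable borel" "q \<in> borel_measurable borel"
    using assms by auto
  show "(\<lambda>(x, y). p x * q y) \<in> borel_measurable (lborel \<Otimes>\<^sub>M lborel)" by measurable
  show "integrable lborel (\<lambda>x. \<integral>y. norm (case (x, y) of (x, y) \<Rightarrow> p x * q y) \<partial>lborel)"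
    by (simp add: abs_mult assms)
  show "AE x in lborel. integrable lborel (\<lambda>y. case (x, y) of (x, y) \<Rightarrow> p x * q y)"
    by (simp add: assms)
qed

text \<open>Scaling by \<open>u\<close> reduces to the Beta integral on the unit interval; the
  exponents add up to -1, which cancels the factor \<open>u\<close> of the substitution. Since the
  value does not depend on \<open>u > 0\<close>, fractional integrations of orders 1-\<beta> and
  \<beta> compose to ordinary integration.\<close>

lemma fpow_convolution:
  assumes "0 < \<beta>" "\<beta> < 1"
  shows "(\<integral>t. fpow (-\<beta>) t * fpow (\<beta> - 1) (u - t) \<partial>lborel) = (if u > 0 then Beta (1 - \<beta>) \<beta> else 0)"
proof (cases "u > 0")
  case True
  have "((\<lambda>t. t powr (1 - \<beta> - 1) * (1 - t) powr (\<beta> - 1)) has_integral Beta (1 - \<beta>) \<beta>) {0..1}"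
    by (rule has_integral_Beta_real) (use assms in auto)
  from has_bochner_integral_lborel_nonneg [OF this]
  have "(\<integral>t. indicator {0..1} t * (t powr (- \<beta>) * (1 - t) powr (\<beta> - 1)) \<partial>lborel) = Beta (1 - \<beta>) \<beta>"
    by (auto simp: has_bochner_integral_iff)
  moreover have "(\<lambda>t. indicator {0..1} t * (t powr (- \<beta>) * (1 - t) powr (\<beta> - 1)))
      = (\<lambda>t. fpow (-\<beta>) t * fpow (\<beta> - 1) (1 - t))"
    by (auto simp: fpow_def indicator_def)
  ultimately have 1: "(\<integral>t. fpow (-\<beta>) t * fpow (\<beta> - 1) (1 - t) \<partial>lborel) = Beta (1 - \<beta>) \<beta>"
    by simp
  have "(\<integral>t. fpow (-\<beta>) t * fpow (\<beta> - 1) (u - t) \<partial>lborel)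
      = u * (\<integral>t. fpow (-\<beta>) (u * t) * fpow (\<beta> - 1) (u * (1 - t)) \<partial>lborel)"
    using True by (subst lborel_integral_real_affine [where c = u and t = 0]) (auto simp: algebra_simps)
  also have "\<dots> = u * (\<integral>t. (u powr (-\<beta>) * u powr (\<beta> - 1)) * (fpow (-\<beta>) t * fpow (\<beta> - 1) (1 - t)) \<partial>lborel)"
    by (simp only: fpow_mult [OF True]) (simp only: mult_ac)
  also have "\<dots> = u * (u powr (-\<beta>) * u powr (\<beta> - 1)) * Beta (1 - \<beta>) \<beta>"
    by (simp only: integral_mult_right_zero 1 mult.assoc)
  also have "u powr (-\<beta>) * u powr (\<beta> - 1) = u powr (- 1)"
    by (simp add: powr_add [symmetric])
  finally show ?thesis using True by (simp add: powr_minus)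
next
  case False
  then have "(\<lambda>t. fpow (-\<beta>) t * fpow (\<beta> - 1) (u - t)) = (\<lambda>t. 0)"
    by (auto simp: fpow_def indicator_def)
  with False show ?thesis by simp
qed

text \<open>Substitute \<open>u = s + t\<close>, exchange the integrals and apply
  \<open>fpow_convolution\<close>. Absolute integrability comes from the exponential bound, which
  splits into a product of two Gamma integrands. The shift \<open>a\<close> is needed at 0 and at
  \<open>h\<close>.\<close>

lemma
  fixes f :: "real \<Rightarrow> real"
  assumes \<beta>: "0 < \<beta>" "\<beta> < 1" and a: "a \<ge> 0"
    and f [measurable]: "f \<in> borel_measurable borel"
    and bound: "\<And>u. u \<ge> 0 \<Longrightarrow> \<bar>f u\<bar> \<le> M * exp (- u)"
  shows integrable_fractional_integral:
      "integrable lborel (\<lambda>t. fpow (-\<beta>) t * (\<integral>s. fpow (\<beta> - 1) s * f (s + (t + a)) \<partial>lborel))"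
    and integral_fractional_integral:
      "(\<integral>t. fpow (-\<beta>) t * (\<integral>s. fpow (\<beta> - 1) s * f (s + (t + a)) \<partial>lborel) \<partial>lborel)
        = Beta (1 - \<beta>) \<beta> * (\<integral>u. indicator {a<..} u * f u \<partial>lborel)"
proof -
  define p where "p = fpow (-\<beta>)"
  define q where "q = fpow (\<beta> - 1)"
  have [measurable]: "p \<in> borel_measurable borel" "q \<in> borel_measurable borel"
    by (auto simp: p_def q_def)
  have nonneg: "p t \<ge> 0" "q t \<ge> 0" for t by (auto simp: p_def q_def fpow_nonneg)
  \<comment> \<open>As both kernels vanish for negative arguments, \<open>f\<close> is only ever
    bounded at nonnegative points.\<close>
  have zero: "p t = 0" "q t = 0" if "t < 0" for t using that by (auto simp: p_def q_def fpow_simps)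
  have M: "M \<ge> 0" using bound [of 0] by simp
  define H where "H t s = p t * (q s * f (s + (t + a)))" for t s
  have H_meas [measurable]: "(\<lambda>(t, s). H t s) \<in> borel_measurable (lborel \<Otimes>\<^sub>M lborel)"
    unfolding H_def by measurable
  have H: "integrable (lborel \<Otimes>\<^sub>M lborel) (\<lambda>(t, s). H t s)"
  proof (rule Bochner_Integration.integrable_bound)
    show "integrable (lborel \<Otimes>\<^sub>M lborel) (\<lambda>(t, s). (M * (p t * exp (- t))) * (q s * exp (- s)))"
      unfolding p_def q_def by (intro integrable_pair_mult integrable_mult_right integrable_fpow_exp) (use \<beta> in auto)
    have "norm (H t s) \<le> norm ((M * (p t * exp (- t))) * (q s * exp (- s)))" for t s
    proof (cases "t < 0 \<or> s < 0")
      case True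
      then show ?thesis by (auto simp: H_def zero)
    next
      case False
      have "\<bar>f (s + (t + a))\<bar> \<le> M * exp (- (s + (t + a)))" using False a by (intro bound) auto
      also have "\<dots> \<le> M * (exp (- t) * exp (- s))"
        using M a by (intro mult_left_mono) (auto simp: exp_add [symmetric])
      finally have "p t * (q s * \<bar>f (s + (t + a))\<bar>) \<le> p t * (q s * (M * (exp (- t) * exp (- s))))"
        by (intro mult_left_mono nonneg)
      then show ?thesis using nonneg M by (simp add: H_def abs_mult mult_ac)
    qed
    then show "AE x in lborel \<Otimes>\<^sub>M lborel. norm (case x of (t, s) \<Rightarrow> H t s)
        \<le> norm (case x of (t, s) \<Rightarrow> (M * (p t * exp (- t))) * (q s * exp (- s)))"
      by auto
  qed measurable
  show "integrable lborel (\<lambda>t. fpow (-\<beta>) t * (\<integral>s. fpow (\<beta> - 1) s * f (s + (t + a)) \<partial>lborel))"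
    using lborel_pair.integrable_fst [OF H] by (simp add: H_def p_def q_def)
  \<comment> \<open>\<open>H\<close> in the sheared variable \<open>u = s + t\<close>. For fixed
    \<open>t\<close> this is a translation, so integrability is carried over section by section,
    which licenses Fubini for \<open>G\<close>.\<close>
  define G where "G t u = p t * (q (u - t) * f (u + a))" for t u
  have H_G: "H t (- t + 1 * u) = G t u" for t u by (simp add: H_def G_def)
  have G: "integrable (lborel \<Otimes>\<^sub>M lborel) (\<lambda>(t, u). G t u)"
  proof (rule lborel_pair.Fubini_integrable)
    show "(\<lambda>(t, u). G t u) \<in> borel_measurable (lborel \<Otimes>\<^sub>M lborel)"
      unfolding G_def by measurable
    have "(\<integral>u. norm (G t u) \<partial>lborel) = (\<integral>s. norm (H t s) \<partial>lborel)" for t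
      unfolding H_G [symmetric]
      by (subst lborel_integral_real_affine [where c = 1 and t = "- t" and f = "\<lambda>s. norm (H t s)"]) auto
    then show "integrable lborel (\<lambda>t. \<integral>u. norm (case (t, u) of (t, u) \<Rightarrow> G t u) \<partial>lborel)"
      using lborel_pair.integrable_fst' [OF integrable_norm [OF H]] by simp
    have "integrable lborel (H t) \<longleftrightarrow> integrable lborel (G t)" for t
      using lborel_integrable_real_affine_iff [of 1 "H t" "- t"] unfolding H_G by simp
    then show "AE t in lborel. integrable lborel (\<lambda>u. case (t, u) of (t, u) \<Rightarrow> G t u)"
      using lborel_pair.AE_integrable_fst' [OF H] by simp
  qed
  have "(\<integral>t. p t * (\<integral>s. q s * f (s + (t + a)) \<partial>lborel) \<partial>lborel) = (\<integral>t. (\<integral>s. H t s \<partial>lborel) \<partial>lborel)"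
    by (simp add: H_def)
  also have "\<dots> = (\<integral>t. (\<integral>u. G t u \<partial>lborel) \<partial>lborel)"
  proof (rule Bochner_Integration.integral_cong [OF refl])
    show "(\<integral>s. H t s \<partial>lborel) = (\<integral>u. G t u \<partial>lborel)" for t
      unfolding H_G [symmetric]
      by (subst lborel_integral_real_affine [where c = 1 and t = "- t" and f = "H t"]) auto
  qed
  also have "\<dots> = (\<integral>u. (\<integral>t. G t u \<partial>lborel) \<partial>lborel)"
    by (rule lborel_pair.Fubini_integral [OF G, symmetric])
  also have "\<dots> = (\<integral>u. f (u + a) * (if u > 0 then Beta (1 - \<beta>) \<beta> else 0) \<partial>lborel)"
    unfolding fpow_convolution [OF \<beta>, symmetric] p_def [symmetric] q_def [symmetric] G_def
    by (simp only: mult.assoc [symmetric] integral_mult_left_zero mult.commute [of "f _"])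
  also have "\<dots> = (\<integral>u. Beta (1 - \<beta>) \<beta> * (indicator {a<..} (a + 1 * u) * f (a + 1 * u)) \<partial>lborel)"
    by (rule Bochner_Integration.integral_cong) (auto simp: indicator_def add.commute)
  also have "\<dots> = Beta (1 - \<beta>) \<beta> * (\<integral>u. indicator {a<..} u * f u \<partial>lborel)"
    by (subst lborel_integral_real_affine [where c = 1 and t = a and f = "\<lambda>u. indicator {a<..} u * f u"])
       (simp_all only: integral_mult_right_zero, auto)
  finally show "(\<integral>t. fpow (-\<beta>) t * (\<integral>s. fpow (\<beta> - 1) s * f (s + (t + a)) \<partial>lborel) \<partial>lborel)
      = Beta (1 - \<beta>) \<beta> * (\<integral>u. indicator {a<..} u * f u \<partial>lborel)"
    by (simp add: p_def q_def)
qed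

text \<open>A Bernoulli-type bound replacing the mean value theorem: with \<open>x = h / v\<close>,
  it combines \<open>ln (1 + x) \<le> x\<close> with \<open>exp y \<ge> 1 + y\<close>.\<close>

lemma powr_neg_diff_le:
  fixes v h \<beta> :: real
  assumes "v > 0" "h > 0" "\<beta> > 0"
  shows "v powr (-\<beta>) - (v + h) powr (-\<beta>) \<le> \<beta> * h * v powr (-\<beta> - 1)"
proof -
  have "v + h = v * (1 + h / v)" using assms by (simp add: field_simps)
  then have eq: "(v + h) powr (-\<beta>) = v powr (-\<beta>) * (1 + h / v) powr (-\<beta>)"
    using assms by (simp only:) (simp add: powr_mult)
  have "1 - \<beta> * (h / v) \<le> 1 - \<beta> * ln (1 + h / v)"
    using assms mult_left_mono [OF ln_add_one_self_le_self [of "h / v"], of \<beta>] by simp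
  also have "\<dots> \<le> exp (- \<beta> * ln (1 + h / v))"
    using exp_ge_add_one_self [of "- \<beta> * ln (1 + h / v)"] by simp
  also have "\<dots> = (1 + h / v) powr (-\<beta>)"
  proof -
    have "1 + h / v > 0" using assms by (simp add: add_pos_pos)
    then show ?thesis by (simp add: powr_def)
  qed
  finally have "v powr (-\<beta>) * (1 - (1 + h / v) powr (-\<beta>)) \<le> v powr (-\<beta>) * (\<beta> * (h / v))"
    by (intro mult_left_mono) auto
  then show ?thesis unfolding eq using assms by (simp add: powr_diff algebra_simps)
qed

text \<open>For \<open>\<beta> < 1\<close>, apply fractional integration of order \<open>1 - \<beta>\<close> to the fractional integral
  \<open>g\<close> of order \<open>\<beta>\<close> of \<open>f\<close>, and subtract its translate by \<open>h\<close>: this yields \<open>\<integral>\<^sub>0\<^sup>h f\<close> up to a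
  constant, as the integral of \<open>g\<close> against a kernel of \<open>L\<^sup>1\<close> norm \<open>O(h\<^bsup>1-\<beta>\<^esup>)\<close>.\<close>

lemma fractional_integral_bound:
  fixes \<beta> :: real
  assumes \<beta>: "0 < \<beta>" "\<beta> \<le> 1"
  obtains C where "C > 0" and "\<And>f M N h. f \<in> borel_measurable borel \<Longrightarrow>
    (\<And>u. u \<ge> 0 \<Longrightarrow> \<bar>f u\<bar> \<le> M * exp (- u)) \<Longrightarrow> h > 0 \<Longrightarrow>
    (\<And>t. t \<ge> 0 \<Longrightarrow> \<bar>\<integral>s. fpow (\<beta> - 1) s * f (s + t) \<partial>lborel\<bar> \<le> N) \<Longrightarrow>
    \<bar>\<integral>u. indicator {0<..h} u * f u \<partial>lborel\<bar> \<le> C * h powr (1 - \<beta>) * N"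
proof -
  have split: "(\<integral>u. indicator {0<..h} u * f u \<partial>lborel)
      = (\<integral>u. indicator {0<..} u * f u \<partial>lborel) - (\<integral>u. indicator {h<..} u * f u \<partial>lborel)"
    if [measurable]: "f \<in> borel_measurable borel"
      and bound: "\<And>u. u \<ge> 0 \<Longrightarrow> \<bar>f u\<bar> \<le> M * exp (- u)" and h: "h > 0"
    for f :: "real \<Rightarrow> real" and M h
  proof -
    have M: "M \<ge> 0" using bound [of 0] by simp
    have int: "integrable lborel (\<lambda>u. indicator {a<..} u * f u)" if "a \<ge> 0" for a
    proof (rule Bochner_Integration.integrable_bound)
      show "integrable lborel (\<lambda>u. M * (fpow 0 u * exp (- u)))"
        by (intro integrable_mult_right integrable_fpow_exp) simp
      show "AE u in lborel. norm (indicator {a<..} u * f u) \<le> norm (M * (fpow 0 u * exp (- u)))"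
        using bound M \<open>a \<ge> 0\<close> by (auto simp: indicator_def fpow_simps abs_mult)
    qed measurable
    have "(\<lambda>u. indicator {0<..h} u * f u) = (\<lambda>u. indicator {0<..} u * f u - indicator {h<..} u * f u)"
      using h by (auto simp: indicator_def)
    then show ?thesis
      using Bochner_Integration.integral_diff [OF int [of 0] int [of h]] h by simp
  qed
  show ?thesis
  \<comment> \<open>For \<beta>=1 the fractional integral is already a tail integral of
    \<open>f\<close>, and the integral over an interval is a difference of two tails. The kernel
    argument needs \<beta><1, as otherwise \<open>t powr (-\<beta>)\<close> is not integrable at
    0.\<close>
  proof (cases "\<beta> = 1")
    case True
    show ?thesis
    proof (rule that [of 2])
      fix f :: "real \<Rightarrow> real" and M N h :: real
      assume f [measurable]: "f \<in> borel_measurable borel"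
        and bound: "\<And>u. u \<ge> 0 \<Longrightarrow> \<bar>f u\<bar> \<le> M * exp (- u)" and h: "h > 0"
        and N: "\<And>t. t \<ge> 0 \<Longrightarrow> \<bar>\<integral>s. fpow (\<beta> - 1) s * f (s + t) \<partial>lborel\<bar> \<le> N"
      have N': "\<bar>\<integral>u. indicator {t<..} u * f u \<partial>lborel\<bar> \<le> N" if "t \<ge> 0" for t
      proof -
        have "(\<integral>u. indicator {t<..} u * f u \<partial>lborel)
            = (\<integral>s. indicator {t<..} (t + 1 * s) * f (t + 1 * s) \<partial>lborel)"
          by (subst lborel_integral_real_affine [where c = 1 and t = t]) auto
        also have "\<dots> = (\<integral>s. fpow (\<beta> - 1) s * f (s + t) \<partial>lborel)"
          by (rule Bochner_Integration.integral_cong)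
             (auto simp: True fpow_def indicator_def add.commute)
        finally show ?thesis using N [OF that] by simp
      qed
      show "\<bar>\<integral>u. indicator {0<..h} u * f u \<partial>lborel\<bar> \<le> 2 * h powr (1 - \<beta>) * N"
      proof -
        have "\<bar>\<integral>u. indicator {0<..h} u * f u \<partial>lborel\<bar> \<le> 2 * N"
          using split [OF f bound h] N' [of 0] N' [of h] h by linarith
        then show ?thesis using h by (simp add: True)
      qed
    qed simp
  next
    case False
    with \<beta> have \<beta>: "0 < \<beta>" "\<beta> < 1" by auto
    define \<kappa> where "\<kappa> = Beta (1 - \<beta>) \<beta>"
    have \<kappa>: "\<kappa> > 0" using \<beta> by (simp add: \<kappa>_def Beta_def Gamma_real_pos)
    \<comment> \<open>One summand \<open>1 / (1 - \<beta>)\<close> comes from the part of the kernel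
      on \<open>[0, h]\<close> in \<open>b1\<close>, the other one and the 1 from the kernel
      difference in \<open>b2\<close>; \<kappa> is the convolution constant.\<close>
    define C where "C = (2 / (1 - \<beta>) + 1) / \<kappa>"
    show ?thesis
    proof (rule that [of C])
      show "C > 0" using \<beta> \<kappa> by (simp add: C_def add_pos_pos)
      fix f :: "real \<Rightarrow> real" and M N h :: real
      assume f [measurable]: "f \<in> borel_measurable borel"
        and bound: "\<And>u. u \<ge> 0 \<Longrightarrow> \<bar>f u\<bar> \<le> M * exp (- u)" and h: "h > 0"
        and N: "\<And>t. t \<ge> 0 \<Longrightarrow> \<bar>\<integral>s. fpow (\<beta> - 1) s * f (s + t) \<partial>lborel\<bar> \<le> N"
      have N0: "N \<ge> 0" using N [of 0] by simp
      define p where "p = fpow (-\<beta>)"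
      have p_meas [measurable]: "p \<in> borel_measurable borel" by (simp add: p_def)
      define g where "g t = (\<integral>s. fpow (\<beta> - 1) s * f (s + t) \<partial>lborel)" for t
      have int0: "integrable lborel (\<lambda>t. p t * g t)"
        and I0: "(\<integral>t. p t * g t \<partial>lborel) = \<kappa> * (\<integral>u. indicator {0<..} u * f u \<partial>lborel)"
        using integrable_fractional_integral [OF \<beta> order_refl f bound]
          integral_fractional_integral [OF \<beta> order_refl f bound]
        by (simp_all add: p_def g_def \<kappa>_def)
      have inth: "integrable lborel (\<lambda>t. p t * g (t + h))"
        and Ih: "(\<integral>t. p t * g (t + h) \<partial>lborel) = \<kappa> * (\<integral>u. indicator {h<..} u * f u \<partial>lborel)"
        using integrable_fractional_integral [OF \<beta> less_imp_le [OF h] f bound]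
          integral_fractional_integral [OF \<beta> less_imp_le [OF h] f bound]
        by (simp_all add: p_def g_def \<kappa>_def)
      have int1: "integrable lborel (\<lambda>t. indicator {..h} t * (p t * g t))"
        and int2: "integrable lborel (\<lambda>t. indicator {h<..} t * (p t * g t))"
        using integrable_mult_indicator [OF _ int0, of "{..h}"]
          integrable_mult_indicator [OF _ int0, of "{h<..}"] by auto
      have int3: "integrable lborel (\<lambda>v. indicator {0<..} v * (p (v + h) * g (v + h)))"
        and I2: "(\<integral>t. indicator {h<..} t * (p t * g t) \<partial>lborel)
          = (\<integral>v. indicator {0<..} v * (p (v + h) * g (v + h)) \<partial>lborel)"
      proof -
        have eq: "(\<lambda>v. indicator {0<..} v * (p (v + h) * g (v + h)))
            = (\<lambda>v. indicator {h<..} (h + 1 * v) * (p (h + 1 * v) * g (h + 1 * v)))"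
          by (auto simp: indicator_def add.commute)
        show "integrable lborel (\<lambda>v. indicator {0<..} v * (p (v + h) * g (v + h)))"
          unfolding eq by (rule lborel_integrable_real_affine [OF int2]) simp
        show "(\<integral>t. indicator {h<..} t * (p t * g t) \<partial>lborel)
            = (\<integral>v. indicator {0<..} v * (p (v + h) * g (v + h)) \<partial>lborel)"
          unfolding eq by (subst lborel_integral_real_affine [where c = 1 and t = h]) auto
      qed
      have "\<kappa> * (\<integral>u. indicator {0<..h} u * f u \<partial>lborel)
          = (\<integral>t. p t * g t \<partial>lborel) - (\<integral>t. p t * g (t + h) \<partial>lborel)"
        using split [OF f bound h] unfolding I0 Ih by (simp add: right_diff_distrib)
      also have "(\<integral>t. p t * g t \<partial>lborel)
          = (\<integral>t. indicator {..h} t * (p t * g t) + indicator {h<..} t * (p t * g t) \<partial>lborel)"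
        by (rule Bochner_Integration.integral_cong) (auto simp: indicator_def)
      also have "\<dots> = (\<integral>t. indicator {..h} t * (p t * g t) \<partial>lborel)
          + (\<integral>v. indicator {0<..} v * (p (v + h) * g (v + h)) \<partial>lborel)"
        by (simp add: Bochner_Integration.integral_add [OF int1 int2] I2)
      \<comment> \<open>The part beyond \<open>h\<close> has been shifted by \<open>h\<close>, so
        that both remaining integrals see \<open>g (v + h)\<close> and only the difference of kernel
        values matters.\<close>
      finally have decomp: "\<kappa> * (\<integral>u. indicator {0<..h} u * f u \<partial>lborel)
          = (\<integral>t. indicator {..h} t * (p t * g t) \<partial>lborel)
            + (\<integral>v. indicator {0<..} v * (p (v + h) * g (v + h)) - p v * g (v + h) \<partial>lborel)"
        by (simp add: Bochner_Integration.integral_diff [OF int3 inth])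
      have near: "has_bochner_integral lborel (\<lambda>t. indicator {0..h} t * t powr (-\<beta>)) (h powr (1 - \<beta>) / (1 - \<beta>))"
      proof (rule has_bochner_integral_lborel_nonneg)
        show "((\<lambda>t. t powr (-\<beta>)) has_integral h powr (1 - \<beta>) / (1 - \<beta>)) {0..h}"
          using has_integral_powr_from_0 [of "-\<beta>" h] \<beta> h by simp
      qed auto
      have far: "has_bochner_integral lborel (\<lambda>t. indicator {h..} t * t powr (-\<beta> - 1)) (h powr (-\<beta>) / \<beta>)"
      proof (rule has_bochner_integral_lborel_nonneg)
        show "((\<lambda>t. t powr (-\<beta> - 1)) has_integral h powr (-\<beta>) / \<beta>) {h..}"
          using has_integral_powr_to_inf [of "-\<beta> - 1" h] \<beta> h by simp
      qed auto
      have b1: "\<bar>\<integral>t. indicator {..h} t * (p t * g t) \<partial>lborel\<bar> \<le> h powr (1 - \<beta>) / (1 - \<beta>) * N"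
      proof -
        have "\<bar>\<integral>t. indicator {..h} t * (p t * g t) \<partial>lborel\<bar>
            \<le> (\<integral>t. (indicator {0..h} t * t powr (-\<beta>)) * N \<partial>lborel)"
        proof (rule integral_abs_bound_integral [OF int1])
          show "integrable lborel (\<lambda>t. (indicator {0..h} t * t powr (-\<beta>)) * N)"
            using near by (intro integrable_mult_left) (simp add: has_bochner_integral_iff)
          show "\<bar>indicator {..h} t * (p t * g t)\<bar> \<le> (indicator {0..h} t * t powr (-\<beta>)) * N" for t
            using N [of t] unfolding g_def [symmetric]
            by (auto simp: p_def fpow_def indicator_def abs_mult intro!: mult_left_mono)
        qed
        also have "\<dots> = h powr (1 - \<beta>) / (1 - \<beta>) * N"
          using near by (simp only: integral_mult_left_zero has_bochner_integral_iff)
        finally show ?thesis .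
      qed
      have b2: "\<bar>\<integral>v. indicator {0<..} v * (p (v + h) * g (v + h)) - p v * g (v + h) \<partial>lborel\<bar>
          \<le> (h powr (1 - \<beta>) / (1 - \<beta>) + \<beta> * h * (h powr (-\<beta>) / \<beta>)) * N"
      proof -
        \<comment> \<open>Majorant of the kernel difference: near the singularity the larger value
          alone, beyond \<open>h\<close> the estimate \<open>powr_neg_diff_le\<close>. Both pieces
          have integrals of order \<open>h powr (1 - \<beta>)\<close>.\<close>
        define m where "m v = indicator {0..h} v * v powr (-\<beta>) + \<beta> * h * (indicator {h..} v * v powr (-\<beta> - 1))" for v
        have m: "has_bochner_integral lborel m (h powr (1 - \<beta>) / (1 - \<beta>) + \<beta> * h * (h powr (-\<beta>) / \<beta>))"
          unfolding m_def by (intro has_bochner_integral_add has_bochner_integral_mult_right near far)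
        have "\<bar>\<integral>v. indicator {0<..} v * (p (v + h) * g (v + h)) - p v * g (v + h) \<partial>lborel\<bar>
            \<le> (\<integral>v. m v * N \<partial>lborel)"
        proof (rule integral_abs_bound_integral [OF Bochner_Integration.integrable_diff [OF int3 inth]])
          show "integrable lborel (\<lambda>v. m v * N)"
            using m by (intro integrable_mult_left) (simp add: has_bochner_integral_iff)
          fix v :: real
          show "\<bar>indicator {0<..} v * (p (v + h) * g (v + h)) - p v * g (v + h)\<bar> \<le> m v * N"
          proof (cases "v > 0")
            case False
            then have "p v = 0" by (simp add: p_def fpow_simps)
            moreover have "m v \<ge> 0" using \<beta> h by (simp add: m_def)
            ultimately show ?thesis using False N0 by simp
          next
            case True
            have "v powr (-\<beta>) - (v + h) powr (-\<beta>) \<le> m v"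
            proof (cases "v \<le> h")
              case True
              with \<open>v > 0\<close> \<beta> h have "v powr (-\<beta>) \<le> m v" by (simp add: m_def)
              moreover have "0 \<le> (v + h) powr (-\<beta>)" by simp
              ultimately show ?thesis by linarith
            next
              case False
              then show ?thesis using powr_neg_diff_le [OF \<open>v > 0\<close> h \<beta>(1)] by (simp add: m_def mult.assoc)
            qed
            moreover have "(v + h) powr (-\<beta>) \<le> v powr (-\<beta>)"
              using True h \<beta> by (intro powr_mono2') auto
            ultimately have "\<bar>p (v + h) - p v\<bar> \<le> m v"
              using True h by (simp add: p_def fpow_simps)
            moreover have "\<bar>g (v + h)\<bar> \<le> N" unfolding g_def using True h by (intro N) simp
            ultimately have "\<bar>p (v + h) - p v\<bar> * \<bar>g (v + h)\<bar> \<le> m v * N"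
              by (intro mult_mono) auto
            then show ?thesis using True by (simp add: abs_mult [symmetric] left_diff_distrib)
          qed
        qed
        also have "\<dots> = (h powr (1 - \<beta>) / (1 - \<beta>) + \<beta> * h * (h powr (-\<beta>) / \<beta>)) * N"
          using m by (simp only: integral_mult_left_zero has_bochner_integral_iff)
        finally show ?thesis .
      qed
      have "h * h powr (-\<beta>) = h powr (1 - \<beta>)"
        using h by (simp add: powr_diff powr_minus divide_inverse)
      then have "h powr (1 - \<beta>) / (1 - \<beta>) + \<beta> * h * (h powr (-\<beta>) / \<beta>) = h powr (1 - \<beta>) / (1 - \<beta>) + h powr (1 - \<beta>)"
        using \<beta> by simp
      with order_trans [OF abs_triangle_ineq add_mono [OF b1 b2]] have "\<bar>\<kappa> * (\<integral>u. indicator {0<..h} u * f u \<partial>lborel)\<bar>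
          \<le> h powr (1 - \<beta>) / (1 - \<beta>) * N + (h powr (1 - \<beta>) / (1 - \<beta>) + h powr (1 - \<beta>)) * N"
        unfolding decomp by simp
      also have "\<dots> = (2 / (1 - \<beta>) + 1) * h powr (1 - \<beta>) * N"
        by (simp add: algebra_simps)
      finally have "\<kappa> * \<bar>\<integral>u. indicator {0<..h} u * f u \<partial>lborel\<bar> \<le> (2 / (1 - \<beta>) + 1) * h powr (1 - \<beta>) * N"
        using \<kappa> by (simp add: abs_mult)
      then show "\<bar>\<integral>u. indicator {0<..h} u * f u \<partial>lborel\<bar> \<le> C * h powr (1 - \<beta>) * N"
        using \<kappa> by (simp add: C_def field_simps)
    qed
  qed
qed

subsection \<open>The moment inequality\<close>

context contraction_semigroup
begin

text \<open>Ensures that \<open>integral\<close> in \<open>resolvent_power\<close> is not a default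
  value, so that bounded functionals may be moved inside. Bounded intervals come from the
  fundamental theorem of calculus, the half-line from domination by a Gamma integrand.\<close>

lemma resolvent_power_integrable:
  assumes \<beta>: "0 < \<beta>"
  shows "(\<lambda>t. (t powr (\<beta> - 1) * exp (- t)) *\<^sub>R T t x) integrable_on {0..}"
proof -
  define F where "F t = (t powr (\<beta> - 1) * exp (- t)) *\<^sub>R T t x" for t
  text \<open>The substitution \<open>v = t powr \<beta>\<close> removes the singularity at \<open>0\<close>.\<close>
  have bounded: "F integrable_on {0..b}" if b: "b > 0" for b
  proof -
    define f where "f v = (1 / \<beta>) *\<^sub>R exp (- (v powr (1 / \<beta>))) *\<^sub>R T (v powr (1 / \<beta>)) x" for v
    define \<Phi> where "\<Phi> v = integral {0..v} f" for v
    have pw: "continuous_on {0..c} (\<lambda>v::real. v powr (1 / \<beta>))" for c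
      using \<beta> by (intro continuous_on_powr' continuous_intros) auto
    have "continuous_on {0..b powr \<beta>} (\<lambda>v. T (v powr (1 / \<beta>)) x)"
      by (rule continuous_on_compose2 [OF continuous_on_orbit pw]) auto
    then have cont: "continuous_on {0..b powr \<beta>} f"
      unfolding f_def by (intro continuous_intros pw) 
    have pow: "continuous_on {0..b} (\<lambda>t. t powr \<beta>)"
      using \<beta> by (intro continuous_on_powr' continuous_intros) auto
    have "continuous_on {0..b} (\<lambda>t. \<Phi> (t powr \<beta>))"
    proof (rule continuous_on_compose2 [OF _ pow])
      show "continuous_on {0..b powr \<beta>} \<Phi>"
        unfolding \<Phi>_def by (intro indefinite_integral_continuous_1 integrable_continuous_real cont)
      show "(\<lambda>t. t powr \<beta>) ` {0..b} \<subseteq> {0..b powr \<beta>}"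
        using \<beta> by (auto intro!: powr_mono2)
    qed
    moreover have "((\<lambda>t. \<Phi> (t powr \<beta>)) has_vector_derivative F t) (at t)" if t: "t \<in> {0<..<b}" for t
    proof -
      have less: "t powr \<beta> < b powr \<beta>" using t \<beta> by (intro powr_less_mono2) auto
      have "(\<Phi> has_vector_derivative f (t powr \<beta>)) (at (t powr \<beta>) within {0..b powr \<beta>})"
        unfolding \<Phi>_def using less by (intro integral_has_vector_derivative cont) auto
      then have \<Phi>: "(\<Phi> has_vector_derivative f (t powr \<beta>)) (at (t powr \<beta>))"
        using t less by (simp add: at_within_Icc_at)
      have "((\<lambda>t. t powr \<beta>) has_real_derivative \<beta> * t powr (\<beta> - 1)) (at t)"
        using t by (auto intro!: derivative_eq_intros)
      then have "((\<lambda>t. t powr \<beta>) has_vector_derivative \<beta> * t powr (\<beta> - 1)) (at t)"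
        by (simp add: has_real_derivative_iff_has_vector_derivative)
      from vector_diff_chain_at [OF this \<Phi>]
      show ?thesis
        using t \<beta> by (simp add: o_def F_def f_def powr_powr)
    qed
    ultimately have "(F has_integral \<Phi> (b powr \<beta>) - \<Phi> (0 powr \<beta>)) {0..b}"
      using b by (intro fundamental_theorem_of_calculus_interior) auto
    then show ?thesis by (rule has_integral_integrable)
  qed
  have "F integrable_on {0..}"
  proof (rule integrable_on_all_intervals_integrable_bound)
    fix a b :: real
    have "F integrable_on {max 0 a..b}"
      by (rule integrable_on_subinterval [OF bounded [of "max 1 b"]]) auto
    moreover have "{0..} \<inter> {a..b} = {max 0 a..b}" by auto
    ultimately show "(\<lambda>x. if x \<in> {0..} then F x else 0) integrable_on cbox a b"
      unfolding integrable_restrict_Int by simp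
    show "norm (F t) \<le> (t powr (\<beta> - 1) / exp t) * norm x" if "t \<in> {0..}" for t
    proof -
      have "norm (F t) = (t powr (\<beta> - 1) / exp t) * norm (T t x)"
        by (simp add: F_def exp_minus divide_inverse)
      also have "\<dots> \<le> (t powr (\<beta> - 1) / exp t) * norm x"
        using that by (intro mult_left_mono contraction) auto
      finally show ?thesis .
    qed
    show "(\<lambda>t. (t powr (\<beta> - 1) / exp t) * norm x) integrable_on {0..}"
      using Gamma_integral_real [OF \<beta>] by (intro integrable_on_mult_left) auto
  qed
  then show ?thesis unfolding F_def .
qed

text \<open>Move the functional \<open>\<lambda>v. rinner (T t v) z\<close> inside the integral; the
  semigroup law and the factor \<open>exp (- t)\<close> then produce \<open>f (s + t)\<close>. This
  turns a bound on the fractional power into a uniform bound on a scalar fractional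
  integral.\<close>

lemma rinner_resolvent_power:
  assumes \<beta>: "0 < \<beta>" and t: "t \<ge> 0"
    and f: "\<And>u. u \<ge> 0 \<Longrightarrow> f u = exp (- u) * rinner (T u x) z"
    and f_meas [measurable]: "f \<in> borel_measurable borel"
  shows "(\<integral>s. fpow (\<beta> - 1) s * f (s + t) \<partial>lborel)
    = Gamma \<beta> * exp (- t) * rinner (T t (resolvent_power T \<beta> x)) z"
proof -
  define F where "F s = (s powr (\<beta> - 1) * exp (- s)) *\<^sub>R T s x" for s
  have F: "F integrable_on {0..}"
    unfolding F_def by (rule resolvent_power_integrable [OF \<beta>])
  have bl: "bounded_linear (\<lambda>v. rinner (T t v) z)"
    by (rule bounded_linear_compose [OF bounded_linear_rinner_left bounded_linear [OF t]])
  have eq: "exp (- t) * rinner (T t (F s)) z = s powr (\<beta> - 1) * f (s + t)" if "s \<ge> 0" for s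
  proof -
    have "T t (F s) = (s powr (\<beta> - 1) * exp (- s)) *\<^sub>R T (s + t) x"
      using that t semigroup [of t s x] by (simp only: F_def scaleR add.commute)
    moreover have "f (s + t) = exp (- t) * (exp (- s) * rinner (T (s + t) x) z)"
      using that t by (simp add: f exp_add [symmetric] mult.assoc [symmetric])
    ultimately show ?thesis by (simp add: rinner_scaleR_left)
  qed
  have "set_integrable lborel {0..} (\<lambda>s. s powr (\<beta> - 1) * f (s + t))"
    unfolding set_integrable_def
  proof (rule Bochner_Integration.integrable_bound)
    show "integrable lborel (\<lambda>s. (norm x * norm z) * (fpow (\<beta> - 1) s * exp (- s)))"
      using \<beta> by (intro integrable_mult_right integrable_fpow_exp) simp
    have "norm (indicator {0..} s *\<^sub>R (s powr (\<beta> - 1) * f (s + t)))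
        \<le> norm ((norm x * norm z) * (fpow (\<beta> - 1) s * exp (- s)))" for s
    proof (cases "s \<ge> 0")
      case True
      have "\<bar>rinner (T (s + t) x) z\<bar> \<le> norm (T (s + t) x) * norm z" by (rule abs_rinner_le_norm)
      also have "\<dots> \<le> norm x * norm z" using True t by (intro mult_right_mono contraction) auto
      finally have "exp (- (s + t)) * \<bar>rinner (T (s + t) x) z\<bar> \<le> exp (- s) * (norm x * norm z)"
        using t by (intro mult_mono) auto
      then have "\<bar>f (s + t)\<bar> \<le> exp (- s) * (norm x * norm z)"
        using True t by (simp add: f abs_mult)
      then have "s powr (\<beta> - 1) * \<bar>f (s + t)\<bar> \<le> s powr (\<beta> - 1) * (exp (- s) * (norm x * norm z))"
        by (intro mult_left_mono) auto
      then show ?thesis using True by (simp add: fpow_def abs_mult mult_ac)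
    qed simp
    then show "AE s in lborel. norm (indicator {0..} s *\<^sub>R (s powr (\<beta> - 1) * f (s + t)))
        \<le> norm ((norm x * norm z) * (fpow (\<beta> - 1) s * exp (- s)))" by simp
  qed measurable
  from set_borel_integral_eq_integral(2) [OF this]
  have "(\<integral>s. fpow (\<beta> - 1) s * f (s + t) \<partial>lborel) = integral {0..} (\<lambda>s. s powr (\<beta> - 1) * f (s + t))"
    by (simp add: set_lebesgue_integral_def fpow_def mult.assoc)
  also have "\<dots> = integral {0..} (\<lambda>s. exp (- t) * rinner (T t (F s)) z)"
    by (rule Henstock_Kurzweil_Integration.integral_cong) (simp add: eq)
  also have "\<dots> = exp (- t) * integral {0..} ((\<lambda>v. rinner (T t v) z) \<circ> F)"
    by (simp add: o_def)
  also have "\<dots> = exp (- t) * rinner (T t (integral {0..} F)) z"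
    by (simp only: integral_linear [OF F bl])
  also have "integral {0..} F = Gamma \<beta> *\<^sub>R resolvent_power T \<beta> x"
    using Gamma_real_pos [OF \<beta>] by (simp add: resolvent_power_def F_def [abs_def])
  finally show ?thesis using t by (simp add: scaleR rinner_scaleR_left)
qed

text \<open>Mean value inequality: the derivative \<open>T t (A x)\<close> is no larger than
  \<open>A x\<close> in norm.\<close>

lemma norm_orbit_minus_le:
  assumes "x \<in> D" and "u \<ge> 0"
  shows "norm (T u x - x) \<le> u * norm (A x)"
proof (cases "u = 0")
  case False
  with assms have "norm (T u x - T 0 x) \<le> u * norm (A x) - 0 * norm (A x)"
  proof (intro differentiable_bound_general)
    show "continuous_on {0..u} (\<lambda>t. T t x)"
      by (rule continuous_on_subset [OF continuous_on_orbit]) auto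
    show "((\<lambda>t. T t x) has_vector_derivative T t (A x)) (at t)" if "0 < t" "t < u" for t
      using orbit_has_vector_derivative [OF assms(1) that(1)] .
    show "((\<lambda>t. t * norm (A x)) has_vector_derivative norm (A x)) (at t)" for t
      unfolding has_real_derivative_iff_has_vector_derivative [symmetric]
      by (auto intro!: derivative_eq_intros)
    show "continuous_on {0..u} (\<lambda>t. t * norm (A x))" by (intro continuous_intros)
    show "norm (T t (A x)) \<le> norm (A x)" if "0 < t" for t using that by (simp add: contraction)
  qed simp
  then show ?thesis by simp
qed simp

text \<open>Integrate \<open>f u = exp (- u) * rinner (T u x) x\<close> over \<open>(0, h]\<close>.
  From below, \<open>f\<close> stays near the squared norm of \<open>x\<close>; from above,
  \<open>fractional_integral_bound\<close> applies with a bound proportional to the fractional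
  power. Dividing by \<open>h * norm x\<close> gives the claim.\<close>

lemma norm_le_resolvent_power:
  assumes \<beta>: "0 < \<beta>" "\<beta> \<le> 1"
  obtains C where "C > 0" and "\<And>x h. x \<in> D \<Longrightarrow> h > 0 \<Longrightarrow>
    norm x \<le> h * (norm x + norm (A x)) + C * h powr (-\<beta>) * norm (resolvent_power T \<beta> x)"
proof -
  obtain C where C: "C > 0" and bound: "\<And>f M N h. f \<in> borel_measurable borel \<Longrightarrow>
    (\<And>u. u \<ge> 0 \<Longrightarrow> \<bar>f u\<bar> \<le> M * exp (- u)) \<Longrightarrow> h > 0 \<Longrightarrow>
    (\<And>t. t \<ge> 0 \<Longrightarrow> \<bar>\<integral>s. fpow (\<beta> - 1) s * f (s + t) \<partial>lborel\<bar> \<le> N) \<Longrightarrow>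
    \<bar>\<integral>u. indicator {0<..h} u * f u \<partial>lborel\<bar> \<le> C * h powr (1 - \<beta>) * N"
  proof (rule fractional_integral_bound [OF \<beta>], goal_cases)
    case (1 C)
    show ?case by (rule 1(1) [OF 1(2,3)])
  qed
  have \<Gamma>: "Gamma \<beta> > 0" using Gamma_real_pos [OF \<beta>(1)] .
  show ?thesis
  proof (rule that [of "C * Gamma \<beta>"])
    show "C * Gamma \<beta> > 0" using C \<Gamma> by simp
    fix x h assume x: "x \<in> D" and h: "(h::real) > 0"
    define y where "y = resolvent_power T \<beta> x"
    define f where "f u = indicator {0..} u *\<^sub>R (exp (- u) * rinner (T u x) x)" for u
    have "continuous_on {0..} (\<lambda>u. exp (- u) * rinner (T u x) x)"
      by (intro continuous_intros continuous_on_orbit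
          bounded_bilinear.continuous_on [OF bounded_bilinear_rinner])
    then have meas [measurable]: "f \<in> borel_measurable borel"
      unfolding f_def by (intro borel_measurable_continuous_on_indicator) auto
    have f: "f u = exp (- u) * rinner (T u x) x" if "u \<ge> 0" for u
      using that by (simp add: f_def)
    have le: "\<bar>rinner (T t v) x\<bar> \<le> norm v * norm x" if "t \<ge> 0" for t v
      using abs_rinner_le_norm [of "T t v" x] mult_right_mono [OF contraction [OF that, of v], of "norm x"]
      by simp
    have fM: "\<bar>f u\<bar> \<le> (norm x * norm x) * exp (- u)" if "u \<ge> 0" for u
      using le [OF that, of x] that by (simp add: f abs_mult)
    have fN: "\<bar>\<integral>s. fpow (\<beta> - 1) s * f (s + t) \<partial>lborel\<bar> \<le> Gamma \<beta> * (norm y * norm x)" if t: "t \<ge> 0" for t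
    proof -
      have "exp (- t) * \<bar>rinner (T t y) x\<bar> \<le> 1 * (norm y * norm x)"
        using le [OF t] t by (intro mult_mono) auto
      then have "Gamma \<beta> * (exp (- t) * \<bar>rinner (T t y) x\<bar>) \<le> Gamma \<beta> * (norm y * norm x)"
        using \<Gamma> by (intro mult_left_mono) auto
      moreover have "\<bar>\<integral>s. fpow (\<beta> - 1) s * f (s + t) \<partial>lborel\<bar> = \<bar>Gamma \<beta> * exp (- t) * rinner (T t y) x\<bar>"
        unfolding y_def by (rule arg_cong [OF rinner_resolvent_power [OF \<beta>(1) t f meas]])
      ultimately show ?thesis using \<Gamma> by (simp add: abs_mult mult.assoc)
    qed
    \<comment> \<open>\<open>u * G\<close> bounds the distance of
      \<open>exp (- u) *\<^sub>R T u x\<close> from \<open>x\<close>.\<close>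
    define G where "G = norm x + norm (A x)"
    define c where "c = (norm x)\<^sup>2 - h * G * norm x"
    have lower: "c \<le> f u" if u: "0 < u" "u \<le> h" for u
    proof -
      have "norm (exp (- u) *\<^sub>R T u x - x) \<le> norm ((exp (- u) - 1) *\<^sub>R T u x) + norm (T u x - x)"
        using norm_triangle_ineq [of "(exp (- u) - 1) *\<^sub>R T u x" "T u x - x"]
        by (simp add: scaleR_diff_left)
      also have "norm ((exp (- u) - 1) *\<^sub>R T u x) \<le> u * norm x"
        using u exp_ge_add_one_self [of "- u"] contraction [of u x]
        by (auto intro!: mult_mono)
      also have "norm (T u x - x) \<le> u * norm (A x)"
        using u by (intro norm_orbit_minus_le x) auto
      also have "u * norm x + u * norm (A x) = u * G" by (simp add: G_def distrib_left)
      also have "\<dots> \<le> h * G" using u by (intro mult_right_mono) (auto simp: G_def)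
      finally have "norm (x - exp (- u) *\<^sub>R T u x) * norm x \<le> h * G * norm x"
        by (intro mult_right_mono) (auto simp: norm_minus_commute)
      then have "rinner (x - exp (- u) *\<^sub>R T u x) x \<le> h * G * norm x"
        using rinner_le_norm order_trans by blast
      then show ?thesis using u by (simp add: f c_def rinner_diff_left rinner_scaleR_left rinner_self)
    qed
    have "h * c = (\<integral>u. indicator {0<..h} u * c \<partial>lborel)"
      using h by simp
    also have "\<dots> \<le> (\<integral>u. indicator {0<..h} u * f u \<partial>lborel)"
    proof (rule integral_mono)
      show "integrable lborel (\<lambda>u. indicator {0<..h} u * c)"
        using h by (intro integrable_mult_left) auto
      show "integrable lborel (\<lambda>u. indicator {0<..h} u * f u)"
      proof (rule Bochner_Integration.integrable_bound)
        show "integrable lborel (\<lambda>u. (norm x * norm x) * (fpow 0 u * exp (- u)))"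
          by (intro integrable_mult_right integrable_fpow_exp) simp
        show "AE u in lborel. norm (indicator {0<..h} u * f u) \<le> norm ((norm x * norm x) * (fpow 0 u * exp (- u)))"
          using fM by (auto simp: indicator_def fpow_simps abs_mult)
      qed measurable
      show "indicator {0<..h} u * c \<le> indicator {0<..h} u * f u" for u
        using lower [of u] by (auto simp: indicator_def)
    qed
    also have "\<dots> \<le> C * h powr (1 - \<beta>) * (Gamma \<beta> * (norm y * norm x))"
      using bound [OF meas fM h fN] by linarith
    also have "\<dots> = h * norm x * (C * Gamma \<beta> * h powr (-\<beta>) * norm y)"
      using h by (simp add: powr_diff powr_minus divide_inverse)
    finally have *: "h * norm x * norm x \<le> h * norm x * (h * G + C * Gamma \<beta> * h powr (-\<beta>) * norm y)"
      by (simp add: c_def power2_eq_square algebra_simps)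
    show "norm x \<le> h * (norm x + norm (A x)) + C * Gamma \<beta> * h powr (-\<beta>) * norm (resolvent_power T \<beta> x)"
    proof (cases "x = 0")
      case True
      then show ?thesis using h C \<Gamma> by simp
    next
      case False
      with h * show ?thesis by (simp add: G_def y_def)
    qed
  qed
qed

text \<open>Optimise the previous estimate over \<open>h\<close>. Allowing any upper bound
  \<open>M\<close> of the graph norm lets one \<open>M\<close> serve along a whole orbit.\<close>

lemma moment_inequality:
  assumes \<beta>: "0 < \<beta>" "\<beta> \<le> 1"
  obtains C where "C > 0" and "\<And>x M. x \<in> D \<Longrightarrow> norm x + norm (A x) \<le> M \<Longrightarrow>
    norm x powr (1 + \<beta>) \<le> C * M powr \<beta> * norm (resolvent_power T \<beta> x)"
proof -
  obtain C where C: "C > 0" and le: "\<And>x h. x \<in> D \<Longrightarrow> h > 0 \<Longrightarrow>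
    norm x \<le> h * (norm x + norm (A x)) + C * h powr (-\<beta>) * norm (resolvent_power T \<beta> x)"
    by (rule norm_le_resolvent_power [OF \<beta>]) (rule that)
  show ?thesis
  proof (rule that [of "2 * C * 2 powr \<beta>"])
    show "2 * C * 2 powr \<beta> > 0" using C by simp
    fix x M assume x: "x \<in> D" and M: "norm x + norm (A x) \<le> M"
    let ?y = "norm (resolvent_power T \<beta> x)"
    show "norm x powr (1 + \<beta>) \<le> 2 * C * 2 powr \<beta> * M powr \<beta> * ?y"
    proof (cases "x = 0")
      case True
      then show ?thesis using C by simp
    next
      case False
      then have pos: "norm x > 0" "M > 0"
        using M norm_ge_zero [of "A x"] zero_less_norm_iff [of x] by linarith+
      \<comment> \<open>Makes the first term at most half of \<open>norm x\<close>, so that it can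
        be absorbed.\<close>
      define h where "h = norm x / (2 * M)"
      have h: "h > 0" using pos by (simp add: h_def)
      have "h * (norm x + norm (A x)) \<le> h * M" using h M by (intro mult_left_mono) auto
      also have "h * M = norm x / 2" using pos by (simp add: h_def)
      finally have "norm x \<le> 2 * (C * h powr (-\<beta>) * ?y)" using le [OF x h] by linarith
      also have "h powr (-\<beta>) = (2 powr \<beta> * M powr \<beta>) / norm x powr \<beta>"
        using pos by (simp add: h_def powr_divide powr_mult powr_minus field_simps)
      finally have "norm x * norm x powr \<beta> \<le> 2 * C * 2 powr \<beta> * M powr \<beta> * ?y"
        using pos by (simp add: field_simps)
      then show ?thesis using pos by (simp add: powr_add)
    qed
  qed
qed

end

subsection \<open>Energy decay of the damped semigroup\<close>

text \<open>Discrete analogue of integrating \<open>a' = - c * a powr (1 + \<beta>)\<close>: the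
  quantity \<open>a k powr (-\<beta>)\<close> grows by at least \<open>\<beta> * c\<close> in each
  step.\<close>

lemma sequence_decay:
  fixes a :: "nat \<Rightarrow> real"
  assumes \<beta>: "\<beta> > 0" and c: "c > 0" and nonneg: "\<And>n. a n \<ge> 0"
    and step: "\<And>n. c * a n powr (1 + \<beta>) \<le> a n - a (Suc n)"
    and n: "n > 0"
  shows "a n \<le> (n * \<beta> * c) powr (- 1 / \<beta>)"
proof (cases "a n = 0")
  case False
  have "decseq a"
  proof (rule decseq_SucI)
    fix k
    have "0 \<le> c * a k powr (1 + \<beta>)" using c by simp
    with step [of k] show "a (Suc k) \<le> a k" by linarith
  qed
  then have pos: "a k > 0" if "k \<le> n" for k
    using nonneg [of n] False decseqD [of a k n] that by force
  have "k * \<beta> * c \<le> a k powr (-\<beta>)" if "k \<le> n" for k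
    using that
  proof (induction k)
    case (Suc k)
    \<comment> \<open>Relative loss in one step. Bernoulli turns the factor \<open>1 - u\<close>
      into \<open>1 + \<beta> * u\<close> for the power \<open>-\<beta>\<close>, and
      \<open>u * a k powr (-\<beta>)\<close> is just \<open>c\<close>.\<close>
    define u where "u = c * a k powr \<beta>"
    have ak: "a k > 0" and ak': "a (Suc k) > 0" using pos Suc.prems by auto
    have u: "u > 0" using c ak by (simp add: u_def)
    have le: "a (Suc k) \<le> a k * (1 - u)"
      using step [of k] ak by (simp add: u_def powr_add algebra_simps)
    then have "a k * (1 - u) > 0" using ak' by linarith
    then have u1: "1 - u > 0" using ak by (simp add: zero_less_mult_iff)
    have "ln (1 - u) \<le> - u" using ln_le_minus_one [OF u1] by simp
    then have "\<beta> * u \<le> -\<beta> * ln (1 - u)" using \<beta> mult_left_mono [of "ln (1 - u)" "- u" \<beta>] by simp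
    then have "1 + \<beta> * u \<le> exp (-\<beta> * ln (1 - u))"
      using exp_ge_add_one_self [of "-\<beta> * ln (1 - u)"] by linarith
    also have "\<dots> = (1 - u) powr (-\<beta>)" using u1 by (simp add: powr_def)
    finally have "a k powr (-\<beta>) * (1 + \<beta> * u) \<le> a k powr (-\<beta>) * (1 - u) powr (-\<beta>)"
      by (intro mult_left_mono) auto
    also have "\<dots> = (a k * (1 - u)) powr (-\<beta>)" using ak u1 by (simp add: powr_mult)
    also have "\<dots> \<le> a (Suc k) powr (-\<beta>)" using le ak' \<beta> by (intro powr_mono2') auto
    finally have "a k powr (-\<beta>) + \<beta> * c * (a k powr (-\<beta>) * a k powr \<beta>) \<le> a (Suc k) powr (-\<beta>)"
      by (simp add: u_def algebra_simps)
    moreover have "a k powr (-\<beta>) * a k powr \<beta> = 1" using ak by (simp add: powr_add [symmetric])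
    ultimately have "a k powr (-\<beta>) + \<beta> * c \<le> a (Suc k) powr (-\<beta>)" by simp
    then show ?case using Suc.IH Suc.prems by (simp add: algebra_simps)
  qed simp
  then have "n * \<beta> * c \<le> a n powr (-\<beta>)" by simp
  then have "(a n powr (-\<beta>)) powr (- 1 / \<beta>) \<le> (n * \<beta> * c) powr (- 1 / \<beta>)"
    using n \<beta> c by (intro powr_mono2') auto
  then show ?thesis using pos [of n] \<beta> by (simp add: powr_powr)
qed simp

locale damped_semigroup =
  T: contraction_semigroup T D A + T\<^sub>B: contraction_semigroup T\<^sub>B D "\<lambda>x. A x - B (cadjoint B x)"
  for T T\<^sub>B :: "real \<Rightarrow> 'x::complex_hilbert \<Rightarrow> 'x" and D :: "'x set" and A :: "'x \<Rightarrow> 'x"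
    and B :: "'u::complex_hilbert \<Rightarrow> 'x" +
  assumes B: "bounded_clinear B"
begin

sublocale adj: bounded_linear "cadjoint B"
  by (rule bounded_linear_cadjoint [OF B])

text \<open>Energy balance by the product rule; moving \<open>B\<close> across the inner product
  turns the feedback term into the squared norm of the output.\<close>

lemma norm_derivative_left:
  assumes "x \<in> D" and "t > 0"
  shows "((\<lambda>t. (norm (T\<^sub>B t x))\<^sup>2) has_real_derivative
      2 * rinner (A (T\<^sub>B t x)) (T\<^sub>B t x) - 2 * (norm (cadjoint B (T\<^sub>B t x)))\<^sup>2) (at t)"
proof -
  let ?y = "T\<^sub>B t x"
  have "((\<lambda>t. T\<^sub>B t x) has_vector_derivative A ?y - B (cadjoint B ?y)) (at t)"
    using T\<^sub>B.orbit_has_vector_derivative [OF assms] T\<^sub>B.orbit_in_domain(2) [OF assms(1), of t] assms(2) by simp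
  from bounded_bilinear.has_vector_derivative [OF bounded_bilinear_rinner this this]
  have "((\<lambda>t. rinner (T\<^sub>B t x) (T\<^sub>B t x)) has_vector_derivative 2 * rinner (A ?y - B (cadjoint B ?y)) ?y) (at t)"
    by (simp add: rinner_commute [of ?y])
  then show ?thesis
    by (simp add: rinner_self rinner_diff_left rinner_cadjoint [OF B] right_diff_distrib
        has_real_derivative_iff_has_vector_derivative)
qed

text \<open>The weight \<open>exp (- c * t)\<close> with \<open>c = \<parallel>B\<^sup>*\<parallel>\<^sup>2\<close> absorbs the term \<open>\<parallel>B\<^sup>* w\<parallel>\<^sup>2\<close>
  in the derivative of \<open>\<parallel>w\<parallel>\<^sup>2\<close>, where \<open>w = T t x - T\<^sub>B t x\<close>; the rest is absorbed by the energy
  loss of \<open>T\<^sub>B\<close>.\<close>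

lemma norm_orbit_diff_damped_le:
  assumes M: "M \<ge> 0" "\<And>y. norm (cadjoint B y) \<le> M * norm y" and x: "x \<in> D" and t: "t \<ge> 0"
  shows "(norm (T t x - T\<^sub>B t x))\<^sup>2 \<le> exp (M\<^sup>2 * t) * (((norm x)\<^sup>2 - (norm (T\<^sub>B t x))\<^sup>2) / 2)"
proof (cases "t = 0")
  case False
  define c where "c = M\<^sup>2"
  define w where "w s = T s x - T\<^sub>B s x" for s
  define b where "b s = cadjoint B (T\<^sub>B s x)" for s
  \<comment> \<open>Half of the energy suffices: its derivative contributes
    \<open>- (norm (b s))\<^sup>2\<close>, exactly what Young's inequality leaves over
    below.\<close>
  define \<Phi> where "\<Phi> s = exp (- c * s) * (norm (w s))\<^sup>2 + (norm (T\<^sub>B s x))\<^sup>2 / 2" for s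
  have "\<Phi> t \<le> \<Phi> 0"
  proof (rule DERIV_nonpos_imp_decreasing_open [where f = \<Phi>])
    fix s assume s: "0 < s" "s < t"
    have inD: "T s x \<in> D" "T\<^sub>B s x \<in> D" using s x by (auto intro: T.orbit_in_domain T\<^sub>B.orbit_in_domain)
    have "(w has_vector_derivative T s (A x) - T\<^sub>B s (A x - B (cadjoint B x))) (at s)"
      unfolding w_def
      by (intro has_vector_derivative_diff T.orbit_has_vector_derivative T\<^sub>B.orbit_has_vector_derivative x s)
    also have "T s (A x) - T\<^sub>B s (A x - B (cadjoint B x)) = A (w s) + B (b s)"
      using s x by (simp add: w_def b_def T.domain_diff [OF inD] T.orbit_in_domain(2) T\<^sub>B.orbit_in_domain(2) [symmetric])
    finally have w: "(w has_vector_derivative A (w s) + B (b s)) (at s)" .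
    from bounded_bilinear.has_vector_derivative [OF bounded_bilinear_rinner this this]
    have "((\<lambda>s. rinner (w s) (w s)) has_vector_derivative 2 * rinner (A (w s) + B (b s)) (w s)) (at s)"
      by (simp add: rinner_commute [of "w s"])
    then have dw: "((\<lambda>s. (norm (w s))\<^sup>2) has_real_derivative 2 * rinner (A (w s) + B (b s)) (w s)) (at s)"
      by (simp add: rinner_self has_real_derivative_iff_has_vector_derivative)
    define d where "d = (- c * exp (- c * s)) * (norm (w s))\<^sup>2
        + exp (- c * s) * (2 * rinner (A (w s) + B (b s)) (w s))
        + (2 * rinner (A (T\<^sub>B s x)) (T\<^sub>B s x) - 2 * (norm (b s))\<^sup>2) / 2"
    have "(\<Phi> has_real_derivative d) (at s)"
      unfolding \<Phi>_def d_def b_def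
      by (rule derivative_eq_intros dw norm_derivative_left [OF x] s refl | simp add: b_def)+
    moreover have "d \<le> 0"
    proof -
      have "rinner (A (w s)) (w s) \<le> 0"
        unfolding w_def using inD by (intro T.dissipative T.domain_diff)
      moreover have "rinner (B (b s)) (w s) \<le> norm (b s) * (M * norm (w s))"
        unfolding rinner_cadjoint [OF B]
        by (rule order_trans [OF rinner_le_norm]) (intro mult_left_mono M, simp)
      \<comment> \<open>Young's inequality; the second term is cancelled by the derivative of the
        exponential weight.\<close>
      moreover have "2 * (norm (b s) * (M * norm (w s))) \<le> (norm (b s))\<^sup>2 + c * (norm (w s))\<^sup>2"
        using sum_squares_bound [of "norm (b s)" "M * norm (w s)"] by (simp add: c_def power_mult_distrib mult_ac)
      ultimately have "2 * rinner (A (w s) + B (b s)) (w s) \<le> (norm (b s))\<^sup>2 + c * (norm (w s))\<^sup>2"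
        by (simp add: rinner_add_left)
      then have "exp (- c * s) * (2 * rinner (A (w s) + B (b s)) (w s))
          \<le> exp (- c * s) * ((norm (b s))\<^sup>2 + c * (norm (w s))\<^sup>2)"
        by (intro mult_left_mono) auto
      also have "\<dots> = exp (- c * s) * (norm (b s))\<^sup>2 - (- c * exp (- c * s)) * (norm (w s))\<^sup>2"
        by (simp add: distrib_left)
      finally have "exp (- c * s) * (2 * rinner (A (w s) + B (b s)) (w s))
          \<le> exp (- c * s) * (norm (b s))\<^sup>2 - (- c * exp (- c * s)) * (norm (w s))\<^sup>2" .
      moreover have "exp (- c * s) * (norm (b s))\<^sup>2 \<le> 1 * (norm (b s))\<^sup>2"
        using s by (intro mult_right_mono) (auto simp: c_def)
      moreover have "(2 * rinner (A (T\<^sub>B s x)) (T\<^sub>B s x) - 2 * (norm (b s))\<^sup>2) / 2 \<le> - (norm (b s))\<^sup>2"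
        using T.dissipative [OF inD(2)] by simp
      ultimately show ?thesis unfolding d_def by linarith
    qed
    ultimately show "\<exists>d. (\<Phi> has_real_derivative d) (at s) \<and> d \<le> 0" by blast
  next
    have "continuous_on {0..t} (\<lambda>s. T s x)" "continuous_on {0..t} (\<lambda>s. T\<^sub>B s x)"
      by (auto intro: continuous_on_subset [OF T.continuous_on_orbit] continuous_on_subset [OF T\<^sub>B.continuous_on_orbit])
    then show "continuous_on {0..t} \<Phi>"
      unfolding \<Phi>_def w_def by (intro continuous_intros) auto
  qed (use t in simp)
  then have "exp (- c * t) * (norm (w t))\<^sup>2 \<le> ((norm x)\<^sup>2 - (norm (T\<^sub>B t x))\<^sup>2) / 2"
    by (simp add: \<Phi>_def w_def diff_divide_distrib)
  then have "exp (c * t) * (exp (- c * t) * (norm (w t))\<^sup>2) \<le> exp (c * t) * (((norm x)\<^sup>2 - (norm (T\<^sub>B t x))\<^sup>2) / 2)"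
    by (intro mult_left_mono) auto
  then show ?thesis by (simp add: mult.assoc [symmetric] exp_add [symmetric] c_def w_def)
qed simp

text \<open>Integrated energy balance with the dissipative term of \<open>A\<close> dropped.
  Monotonicity of the integral minus \<open>E\<close> is used, so that only the continuous function
  \<open>b\<close> has to be integrated.\<close>

lemma integral_damping_le:
  assumes x: "x \<in> D" and \<tau>: "\<tau> > 0"
  shows "integral {0..\<tau>} (\<lambda>t. (norm (cadjoint B (T\<^sub>B t x)))\<^sup>2) \<le> ((norm x)\<^sup>2 - (norm (T\<^sub>B \<tau> x))\<^sup>2) / 2"
proof -
  define E where "E t = - ((norm (T\<^sub>B t x))\<^sup>2 / 2)" for t
  have orbit: "continuous_on {0..\<tau>} (\<lambda>s. T\<^sub>B s x)"
    by (auto intro: continuous_on_subset [OF T\<^sub>B.continuous_on_orbit])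
  define b where "b t = (norm (cadjoint B (T\<^sub>B t x)))\<^sup>2" for t
  have b: "continuous_on {0..\<tau>} b"
    unfolding b_def by (intro continuous_intros adj.continuous_on orbit)
  have "integral {0..\<tau>} b - E \<tau> \<le> integral {0..0} b - E 0"
  proof (rule DERIV_nonpos_imp_decreasing_open [where f = "\<lambda>t. integral {0..t} b - E t"])
    fix t assume t: "0 < t" "t < \<tau>"
    have "((\<lambda>t. integral {0..t} b) has_real_derivative b t) (at t within {0..\<tau>})"
      using t by (intro integral_has_real_derivative b) auto
    then have "((\<lambda>t. integral {0..t} b) has_real_derivative b t) (at t)"
      using t by (simp add: at_within_Icc_at)
    moreover have "(E has_real_derivative - ((2 * rinner (A (T\<^sub>B t x)) (T\<^sub>B t x) - 2 * b t) / 2)) (at t)"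
      unfolding E_def b_def by (intro DERIV_minus DERIV_cdivide norm_derivative_left x t)
    ultimately have "((\<lambda>t. integral {0..t} b - E t) has_real_derivative
        rinner (A (T\<^sub>B t x)) (T\<^sub>B t x)) (at t)"
      by (rule DERIV_cong [OF DERIV_diff]) (simp add: field_simps)
    moreover have "rinner (A (T\<^sub>B t x)) (T\<^sub>B t x) \<le> 0"
      using t x by (intro T.dissipative T\<^sub>B.orbit_in_domain) auto
    ultimately show "\<exists>d. ((\<lambda>t. integral {0..t} b - E t) has_real_derivative d) (at t) \<and> d \<le> 0"
      by blast
  next
    show "continuous_on {0..\<tau>} (\<lambda>t. integral {0..t} b - E t)"
      unfolding E_def
      by (intro continuous_intros orbit indefinite_integral_continuous_1 integrable_continuous_real b) auto
  qed (use \<tau> in simp)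
  then show ?thesis unfolding b_def [symmetric] by (simp add: E_def diff_divide_distrib)
qed

text \<open>Split \<open>T t x\<close> into the damped orbit and the difference \<open>w\<close>.
  The first part is controlled by the dissipation integral, the second by
  \<open>norm_orbit_diff_damped_le\<close>, both in terms of the energy loss up to \<tau>.\<close>

lemma integral_undamped_le:
  assumes \<tau>: "\<tau> > 0"
  obtains C where "C > 0" and "\<And>x. x \<in> D \<Longrightarrow>
    integral {0..\<tau>} (\<lambda>t. (norm (cadjoint B (T t x)))\<^sup>2) \<le> C * ((norm x)\<^sup>2 - (norm (T\<^sub>B \<tau> x))\<^sup>2)"
proof -
  obtain M where M: "M \<ge> 0" "\<And>y. norm (cadjoint B y) \<le> M * norm y"
    using adj.nonneg_bounded by (auto simp: mult.commute)
  show ?thesis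
  proof (rule that [of "1 + M\<^sup>2 * exp (M\<^sup>2 * \<tau>) * \<tau>"])
    show "0 < 1 + M\<^sup>2 * exp (M\<^sup>2 * \<tau>) * \<tau>" using \<tau> by (simp add: add_pos_nonneg)
    fix x assume x: "x \<in> D"
    define \<Delta> where "\<Delta> = (norm x)\<^sup>2 - (norm (T\<^sub>B \<tau> x))\<^sup>2"
    define b where "b t = (norm (cadjoint B (T\<^sub>B t x)))\<^sup>2" for t
    have "continuous_on {0..\<tau>} (\<lambda>s. T s x)" "continuous_on {0..\<tau>} (\<lambda>s. T\<^sub>B s x)"
      by (auto intro: continuous_on_subset [OF T.continuous_on_orbit] continuous_on_subset [OF T\<^sub>B.continuous_on_orbit])
    then have cont: "continuous_on {0..\<tau>} (\<lambda>t. (norm (cadjoint B (T t x)))\<^sup>2)" "continuous_on {0..\<tau>} b"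
      unfolding b_def by (intro continuous_intros adj.continuous_on; simp)+
    have pointwise: "(norm (cadjoint B (T t x)))\<^sup>2 \<le> 2 * b t + M\<^sup>2 * exp (M\<^sup>2 * \<tau>) * \<Delta>"
      if t: "t \<in> {0..\<tau>}" for t
    proof -
      define w where "w = T t x - T\<^sub>B t x"
      have "(norm (T\<^sub>B \<tau> x))\<^sup>2 \<le> (norm (T\<^sub>B t x))\<^sup>2"
        using t by (intro power_mono T\<^sub>B.norm_antimono) auto
      moreover have "(norm (T\<^sub>B t x))\<^sup>2 \<le> (norm x)\<^sup>2"
        using t by (intro power_mono T\<^sub>B.contraction) auto
      ultimately have "exp (M\<^sup>2 * t) * (((norm x)\<^sup>2 - (norm (T\<^sub>B t x))\<^sup>2) / 2) \<le> exp (M\<^sup>2 * \<tau>) * (\<Delta> / 2)"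
        using t by (intro mult_mono) (auto simp: \<Delta>_def intro!: mult_left_mono)
      with norm_orbit_diff_damped_le [OF M x, of t] t have w: "(norm w)\<^sup>2 \<le> exp (M\<^sup>2 * \<tau>) * (\<Delta> / 2)"
        unfolding w_def by simp
      have "norm (cadjoint B (T t x)) \<le> norm (cadjoint B (T\<^sub>B t x)) + norm (cadjoint B w)"
        using norm_triangle_ineq [of "cadjoint B (T\<^sub>B t x)" "cadjoint B w"] by (simp add: w_def adj.diff)
      then have "(norm (cadjoint B (T t x)))\<^sup>2 \<le> (norm (cadjoint B (T\<^sub>B t x)) + norm (cadjoint B w))\<^sup>2"
        by (intro power_mono) auto
      also have "\<dots> \<le> 2 * b t + 2 * (norm (cadjoint B w))\<^sup>2"
        using sum_squares_bound [of "norm (cadjoint B (T\<^sub>B t x))" "norm (cadjoint B w)"]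
        by (simp add: b_def power2_sum)
      also have "(norm (cadjoint B w))\<^sup>2 \<le> (M * norm w)\<^sup>2" by (intro power_mono M) auto
      also have "\<dots> = M\<^sup>2 * (norm w)\<^sup>2" by (simp add: power_mult_distrib)
      also have "\<dots> \<le> M\<^sup>2 * (exp (M\<^sup>2 * \<tau>) * (\<Delta> / 2))" by (intro mult_left_mono w) auto
      finally show ?thesis by simp
    qed
    have "integral {0..\<tau>} (\<lambda>t. (norm (cadjoint B (T t x)))\<^sup>2)
        \<le> integral {0..\<tau>} (\<lambda>t. 2 * b t + M\<^sup>2 * exp (M\<^sup>2 * \<tau>) * \<Delta>)"
      by (intro integral_le integrable_continuous_real continuous_intros cont pointwise)
    also have "\<dots> = 2 * integral {0..\<tau>} b + M\<^sup>2 * exp (M\<^sup>2 * \<tau>) * \<Delta> * \<tau>"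
      using \<tau> by (subst Henstock_Kurzweil_Integration.integral_add)
        (simp_all add: integrable_continuous_real continuous_on_mult_left cont)
    also have "2 * integral {0..\<tau>} b \<le> \<Delta>"
      using integral_damping_le [OF x \<tau>] unfolding b_def \<Delta>_def by simp
    finally show "integral {0..\<tau>} (\<lambda>t. (norm (cadjoint B (T t x)))\<^sup>2)
        \<le> (1 + M\<^sup>2 * exp (M\<^sup>2 * \<tau>) * \<tau>) * ((norm x)\<^sup>2 - (norm (T\<^sub>B \<tau> x))\<^sup>2)"
      unfolding \<Delta>_def [symmetric] by (simp add: algebra_simps)
  qed
qed

end

section \<open>From observability to decay rates\<close>

context damped_semigroup
begin

lemma polynomial_decay:
  assumes K: "K > 0" and \<tau>: "\<tau> > 0" and \<beta>: "0 < \<beta>" "\<beta> \<le> 1"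
    and observability: "\<And>x. (norm (resolvent_power T \<beta> x))\<^sup>2
      \<le> K * integral {0..\<tau>} (\<lambda>t. (norm (cadjoint B (T t x)))\<^sup>2)"
  obtains C where "C > 0" and "\<And>x t. x \<in> D \<Longrightarrow> t \<ge> \<tau> \<Longrightarrow>
    norm (T\<^sub>B t x) \<le> C * t powr (- 1 / (2 * \<beta>)) * (norm x + norm (A x - B (cadjoint B x)))"
proof -
  obtain C1 where C1: "C1 > 0" "\<And>x M. x \<in> D \<Longrightarrow> norm x + norm (A x) \<le> M \<Longrightarrow>
    norm x powr (1 + \<beta>) \<le> C1 * M powr \<beta> * norm (resolvent_power T \<beta> x)"
    by (rule T.moment_inequality [OF \<beta>]) blast
  obtain C2 where C2: "C2 > 0" "\<And>x. x \<in> D \<Longrightarrow>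
    integral {0..\<tau>} (\<lambda>t. (norm (cadjoint B (T t x)))\<^sup>2) \<le> C2 * ((norm x)\<^sup>2 - (norm (T\<^sub>B \<tau> x))\<^sup>2)"
    by (rule integral_undamped_le [OF \<tau>]) blast
  have "bounded_linear B" using B by (simp add: bounded_clinear_def)
  from bounded_linear.nonneg_bounded [OF bounded_linear_compose [OF this adj.bounded_linear_axioms]]
  obtain L where L: "L \<ge> 0" "\<And>x. norm (B (cadjoint B x)) \<le> L * norm x"
    by (auto simp: mult.commute)
  \<comment> \<open>Constants of the moment inequality (squared), observability and energy loss. The
    factor depending on the initial value is kept apart in \<open>M\<close>.\<close>
  define c where "c = inverse (C1\<^sup>2 * K * C2)"
  have c: "c > 0" using C1 C2 K by (simp add: c_def)
  \<comment> \<open>The factor \<open>2 * \<tau>\<close> comes from comparing \<open>t\<close> with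
    the number of steps, \<open>1 + L\<close> from changing graph norms; the exponent is halved
    because the energy is a squared norm.\<close>
  define C where "C = (\<beta> * c / (2 * \<tau>)) powr (- 1 / (2 * \<beta>)) * (1 + L)"
  show ?thesis
  proof (rule that [of C])
    show "C > 0" using c \<beta> \<tau> L by (simp add: C_def)
    fix x t assume x: "x \<in> D" and t: "t \<ge> \<tau>"
    let ?A = "\<lambda>x. A x - B (cadjoint B x)"
    show "norm (T\<^sub>B t x) \<le> C * t powr (- 1 / (2 * \<beta>)) * (norm x + norm (?A x))"
    proof (cases "x = 0")
      case True
      then have "T\<^sub>B t x = 0" using T\<^sub>B.contraction [of t x] t \<tau> by simp
      then show ?thesis using C_def L by simp
    next
      case False
      \<comment> \<open>The graph norm of the damped generator does not increase along its orbit;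
        the factor \<open>1 + L\<close> converts it into the graph norm of \<open>A\<close>, as
        required by the moment inequality.\<close>
      define M where "M = (1 + L) * (norm x + norm (?A x))"
      have M: "M > 0" using False L by (simp add: M_def add_pos_nonneg)
      have graph_norm: "norm y + norm (A y) \<le> M" if y: "y = T\<^sub>B s x" "s \<ge> 0" for y s
      proof -
        have "?A y = T\<^sub>B s (?A x)" using T\<^sub>B.orbit_in_domain [OF x y(2)] y by simp
        then have "norm (?A y) \<le> norm (?A x)" using T\<^sub>B.contraction y by metis
        moreover have ny: "norm y \<le> norm x" using T\<^sub>B.contraction y by simp
        moreover have "norm (A y) \<le> norm (?A y) + norm (B (cadjoint B y))"
          using norm_triangle_ineq [of "?A y" "B (cadjoint B y)"] by simp
        moreover have "norm (B (cadjoint B y)) \<le> L * norm x"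
          using L(2) [of y] mult_left_mono [OF ny L(1)] by linarith
        moreover have "0 \<le> L * norm (?A x)" using L by simp
        ultimately show ?thesis unfolding M_def by (simp add: algebra_simps)
      qed
      define a where "a n = (norm (T\<^sub>B (real n * \<tau>) x))\<^sup>2" for n
      have step: "(c / M powr (2 * \<beta>)) * a n powr (1 + \<beta>) \<le> a n - a (Suc n)" for n
      proof -
        define y where "y = T\<^sub>B (real n * \<tau>) x"
        have y: "y \<in> D" using x \<tau> by (auto simp: y_def intro: T\<^sub>B.orbit_in_domain)
        have an: "a n = (norm y)\<^sup>2" by (simp add: a_def y_def)
        then have an_pow: "a n powr (1 + \<beta>) = (norm y powr (1 + \<beta>))\<^sup>2"
          by (simp add: powr_mult power2_eq_square)
        have Suc: "a (Suc n) = (norm (T\<^sub>B \<tau> y))\<^sup>2"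
          using T\<^sub>B.semigroup [of \<tau> "real n * \<tau>" x] \<tau> by (simp add: a_def y_def distrib_right)
        have "norm y powr (1 + \<beta>) \<le> C1 * M powr \<beta> * norm (resolvent_power T \<beta> y)"
          using \<tau> by (intro C1 y graph_norm [OF y_def]) simp
        then have "(norm y powr (1 + \<beta>))\<^sup>2 \<le> (C1 * M powr \<beta> * norm (resolvent_power T \<beta> y))\<^sup>2"
          by (intro power_mono) auto
        also have "\<dots> = C1\<^sup>2 * M powr (2 * \<beta>) * (norm (resolvent_power T \<beta> y))\<^sup>2"
          by (simp add: power_mult_distrib power2_eq_square powr_add [symmetric])
        also have "\<dots> \<le> C1\<^sup>2 * M powr (2 * \<beta>) * (K * (C2 * ((norm y)\<^sup>2 - (norm (T\<^sub>B \<tau> y))\<^sup>2)))"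
          using order_trans [OF observability [of y] mult_left_mono [OF C2(2) [OF y] less_imp_le [OF K]]]
          by (intro mult_left_mono) auto
        finally have "a n powr (1 + \<beta>) \<le> M powr (2 * \<beta>) * (C1\<^sup>2 * K * C2) * (a n - a (Suc n))"
          using an_pow an Suc by (simp add: mult_ac)
        then show ?thesis
          using C1 C2 K M by (simp add: c_def field_simps)
      qed
      \<comment> \<open>Number of complete periods before \<open>t\<close>. It is at least 1, hence
        \<open>t / \<tau> < n + 1 \<le> 2 * n\<close>, which gives \<open>n2\<close>.\<close>
      define n where "n = nat \<lfloor>t / \<tau>\<rfloor>"
      have t1: "t / \<tau> \<ge> 1" using t \<tau> by simp
      have n_le: "real n \<le> t / \<tau>" and n_ge: "t / \<tau> < real n + 1"
        using t1 by (auto simp: n_def)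
      have n: "n > 0" using t1 n_ge by linarith
      have n2: "t / (2 * \<tau>) \<le> real n" using n_ge n by (simp add: field_simps)
      have nt: "real n * \<tau> \<le> t" using n_le \<tau> by (simp add: field_simps)
      have "(norm (T\<^sub>B t x))\<^sup>2 \<le> a n"
        unfolding a_def using nt \<tau> by (intro power_mono T\<^sub>B.norm_antimono) auto
      also have "a n \<le> (n * \<beta> * (c / M powr (2 * \<beta>))) powr (- 1 / \<beta>)"
        using c M by (intro sequence_decay \<beta> step n) (auto simp: a_def)
      also have "\<dots> \<le> (t / (2 * \<tau>) * \<beta> * (c / M powr (2 * \<beta>))) powr (- 1 / \<beta>)"
        using n2 \<beta> c M t \<tau> by (intro powr_mono2' mult_right_mono) auto
      also have "\<dots> = ((\<beta> * c / (2 * \<tau>)) * t * M powr (- 2 * \<beta>)) powr (- 1 / \<beta>)"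
        using M by (simp add: powr_minus field_simps)
      also have "\<dots> = (\<beta> * c / (2 * \<tau>)) powr (- 1 / \<beta>) * t powr (- 1 / \<beta>) * (M powr (- 2 * \<beta>)) powr (- 1 / \<beta>)"
        by (simp only: powr_mult)
      also have "(M powr (- 2 * \<beta>)) powr (- 1 / \<beta>) = M\<^sup>2"
        using \<beta> M by (simp add: powr_powr)
      also have "(\<beta> * c / (2 * \<tau>)) powr (- 1 / \<beta>) * t powr (- 1 / \<beta>) * M\<^sup>2
          = ((\<beta> * c / (2 * \<tau>)) powr (- 1 / (2 * \<beta>)) * t powr (- 1 / (2 * \<beta>)) * M)\<^sup>2"
      proof -
        have "- 1 / (2 * \<beta>) + - 1 / (2 * \<beta>) = - 1 / \<beta>" using \<beta> by (simp add: field_simps)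
        then have "s powr (- 1 / \<beta>) = (s powr (- 1 / (2 * \<beta>)))\<^sup>2" for s :: real
          by (simp only: power2_eq_square powr_add [symmetric])
        then show ?thesis by (simp only: power_mult_distrib)
      qed
      finally have "norm (T\<^sub>B t x) \<le> (\<beta> * c / (2 * \<tau>)) powr (- 1 / (2 * \<beta>)) * t powr (- 1 / (2 * \<beta>)) * M"
        by (rule power2_le_imp_le) (use M in simp)
      also have "\<dots> = C * t powr (- 1 / (2 * \<beta>)) * (norm x + norm (?A x))"
        by (simp only: C_def M_def mult_ac)
      finally show ?thesis .
    qed
  qed
qed

text \<open>The image of \<open>x\<close> under the damped generator may lie outside
  \<open>D\<close>, but it is a limit of difference quotients in \<open>D\<close>, and contractivity
  makes this approximation uniform in time.\<close>

lemma tendsto_zero_of_domain: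
  assumes "\<And>x. x \<in> D \<Longrightarrow> ((\<lambda>t. norm (T\<^sub>B t x)) \<longlongrightarrow> 0) at_top" and x: "x \<in> D"
  shows "((\<lambda>t. norm (T\<^sub>B t (A x - B (cadjoint B x)))) \<longlongrightarrow> 0) at_top"
proof (rule tendstoI)
  fix e :: real assume e: "e > 0"
  define z where "z = A x - B (cadjoint B x)"
  define q where "q h = (1 / h) *\<^sub>R (T\<^sub>B h x - x)" for h
  have "eventually (\<lambda>h. dist (q h) z < e / 2 \<and> h > 0) (at_right 0)"
    using e unfolding q_def z_def
    by (intro eventually_conj tendstoD [OF T\<^sub>B.generator_tendsto [OF x]] eventually_at_right_less) auto
  then obtain h where h: "norm (z - q h) < e / 2" "h > 0"
    using eventually_happens' [of "at_right (0::real)"] by (auto simp: dist_norm norm_minus_commute)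
  have "q h \<in> D"
    unfolding q_def using h x by (intro T\<^sub>B.domain_scaleR T\<^sub>B.domain_diff T\<^sub>B.orbit_in_domain) auto
  then have "eventually (\<lambda>t. norm (T\<^sub>B t (q h)) < e / 2) at_top"
    using tendstoD [OF assms(1), of "q h" "e / 2"] e by simp
  then have "eventually (\<lambda>t. norm (T\<^sub>B t z) < e) at_top"
    using eventually_ge_at_top [of 0]
  proof eventually_elim
    case (elim t)
    have "T\<^sub>B t z = T\<^sub>B t (q h) + T\<^sub>B t (z - q h)" using elim by (simp add: T\<^sub>B.diff)
    then have "norm (T\<^sub>B t z) \<le> norm (T\<^sub>B t (q h)) + norm (T\<^sub>B t (z - q h))"
      by (metis norm_triangle_ineq)
    also have "norm (T\<^sub>B t (z - q h)) \<le> norm (z - q h)" using elim by (intro T\<^sub>B.contraction)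
    finally show ?case using elim h by linarith
  qed
  then show "eventually (\<lambda>t. dist (norm (T\<^sub>B t (A x - B (cadjoint B x)))) 0 < e) at_top"
    by (simp add: z_def)
qed

end

theorem theorem4p2:
  fixes T T\<^sub>B :: "real \<Rightarrow> 'x::complex_hilbert \<Rightarrow> 'x"
    and A :: "'x \<Rightarrow> 'x" and D :: "'x set"
    and B :: "'u::complex_hilbert \<Rightarrow> 'x"
    and K \<tau> \<beta> :: real
  assumes "contraction_C0_semigroup T"
    and "is_generator T D A"
    and "bounded_clinear B"
    and "contraction_C0_semigroup T\<^sub>B"
    and "is_generator T\<^sub>B D (\<lambda>x. A x - B (cadjoint B x))"
    and "K > 0" and "\<tau> > 0" and "0 < \<beta>" and "\<beta> \<le> 1"
    and "\<And>x. (norm (resolvent_power T \<beta> x))\<^sup>2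
           \<le> K * integral {0..\<tau>} (\<lambda>t. (norm (cadjoint B (T t x)))\<^sup>2)"
  shows "\<forall>x\<in>D. (\<lambda>t. norm (T\<^sub>B t x)) \<in> o[at_top](\<lambda>t. t powr (- 1 / (2 * \<beta>)))"
proof
  interpret damped_semigroup T T\<^sub>B D A B
    by unfold_locales (fact assms)+
  let ?A = "\<lambda>x. A x - B (cadjoint B x)"
  define r where "r = - 1 / (2 * \<beta>)"
  have r: "r < 0" using assms by (simp add: r_def)
  obtain C where C: "C > 0" and decay: "\<And>x t. x \<in> D \<Longrightarrow> t \<ge> \<tau> \<Longrightarrow>
      norm (T\<^sub>B t x) \<le> C * t powr r * (norm x + norm (?A x))"
    unfolding r_def by (rule polynomial_decay [OF assms(6-10)]) blast
  \<comment> \<open>The uniform rate is first used only qualitatively, to get convergence to 0 on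
    \<open>D\<close>.\<close>
  have stable: "((\<lambda>t. norm (T\<^sub>B t x)) \<longlongrightarrow> 0) at_top" if x: "x \<in> D" for x
  proof (rule Lim_null_comparison)
    show "eventually (\<lambda>t. norm (norm (T\<^sub>B t x)) \<le> C * t powr r * (norm x + norm (?A x))) at_top"
      using eventually_ge_at_top [of \<tau>] by eventually_elim (simp add: decay x)
    have "((\<lambda>t::real. t powr r) \<longlongrightarrow> 0) at_top"
      by (rule tendsto_neg_powr [OF r filterlim_ident])
    then show "((\<lambda>t. C * t powr r * (norm x + norm (?A x))) \<longlongrightarrow> 0) at_top"
      by (intro tendsto_mult_left_zero tendsto_mult_right_zero)
  qed
  fix x assume x: "x \<in> D"
  \<comment> \<open>Graph norm of \<open>T\<^sub>B t x\<close> for the damped generator, which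
    commutes with \<open>T\<^sub>B t\<close>.\<close>
  define \<epsilon> where "\<epsilon> t = norm (T\<^sub>B t x) + norm (T\<^sub>B t (?A x))" for t
  have \<epsilon>: "(\<epsilon> \<longlongrightarrow> 0) at_top"
    unfolding \<epsilon>_def using tendsto_add [OF stable [OF x] tendsto_zero_of_domain [OF stable x]] by simp
  text \<open>Splitting \<open>T\<^sub>B t = T\<^sub>B (t / 2) T\<^sub>B (t / 2)\<close> turns the big-O rate into little-o.\<close>
  have bound: "norm (T\<^sub>B t x) \<le> C * (1 / 2) powr r * t powr r * \<epsilon> (t / 2)" if t: "t \<ge> 2 * \<tau>" for t
  proof -
    have t2: "t / 2 \<ge> 0" "t / 2 \<ge> \<tau>" using t assms(7) by auto
    have "norm (T\<^sub>B t x) = norm (T\<^sub>B (t / 2) (T\<^sub>B (t / 2) x))"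
      using T\<^sub>B.semigroup [OF t2(1) t2(1), of x] by simp
    also have "\<dots> \<le> C * (t / 2) powr r * \<epsilon> (t / 2)"
      using decay [OF T\<^sub>B.orbit_in_domain(1) [OF x t2(1)] t2(2)]
      unfolding T\<^sub>B.orbit_in_domain(2) [OF x t2(1)] \<epsilon>_def .
    also have "(t / 2) powr r = (1 / 2) powr r * t powr r"
      using powr_mult [of "1 / 2" t r] by simp
    finally show ?thesis by (simp add: mult.assoc)
  qed
  show "(\<lambda>t. norm (T\<^sub>B t x)) \<in> o[at_top](\<lambda>t. t powr (- 1 / (2 * \<beta>)))"
    unfolding r_def [symmetric]
  proof (rule landau_o.smallI)
    fix c :: real assume c: "c > 0"
    have "filterlim (\<lambda>t::real. t / 2) at_top at_top"
      unfolding filterlim_at_top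
      by (intro allI eventually_mono [OF eventually_ge_at_top]) (simp add: le_divide_eq)
    then have "((\<lambda>t. C * (1 / 2) powr r * \<epsilon> (t / 2)) \<longlongrightarrow> C * (1 / 2) powr r * 0) at_top"
      by (intro tendsto_mult_left filterlim_compose [OF \<epsilon>])
    then have "eventually (\<lambda>t. C * (1 / 2) powr r * \<epsilon> (t / 2) < c) at_top"
      using c by (intro order_tendstoD(2)) auto
    then show "eventually (\<lambda>t. norm (norm (T\<^sub>B t x)) \<le> c * norm (t powr r)) at_top"
      using eventually_ge_at_top [of "2 * \<tau>"]
    proof eventually_elim
      case (elim t)
      have "norm (T\<^sub>B t x) \<le> (C * (1 / 2) powr r * \<epsilon> (t / 2)) * t powr r"
        using bound [OF elim(2)] by (simp add: mult_ac)
      also have "\<dots> \<le> c * t powr r" using elim by (intro mult_right_mono) auto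
      finally show ?case by simp
    qed
  qed
qed

end
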